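(* Let $y$ be the solution of the weighted Toeplitz regularized least-squares problem $$\min_{y\in\mathbb R^n}\left\|\begin{bmatrix}W^{1/2}Q\\ \sqrt\lambda I_n\end{bmatrix}y-\begin{bmatrix}W^{1/2}f\\ \mathbf 0\end{bmatrix}\right\|_2^2,$$ where the weight matrix $W$ and the regularization matrix are not perturbed, and let $\mathbf r=W(f-Qy)$, $\widetilde S=-(\lambda I_n+Q^{\mathsf T}WQ)$, $\widetilde K=-\widetilde S^{-1}Q^{\mathsf T}W$. Assume $y\ne\mathbf 0$ (and, for the formula for $\widehat{\mathscr C}^{rls}$, that all entries of $y$ are nonzero). Then the structured normwise, mixed and componentwise condition numbers of $y$ are $$\widehat{\mathscr K}^{rls}(y)=\frac{\left\|\begin{bmatrix}(\widetilde K\otimes y^{\mathsf T}+\mathbf r^{\mathsf T}\otimes\widetilde S^{-1})\Phi_{\mathcal T_{nm}}\mathfrak D_{\mathcal T_{nm}}^{-1}&-\widetilde K\end{bmatrix}\right\|_2\left\|\begin{bmatrix}Q&f\end{bmatrix}\right\|_F}{\|y\|_2},$$ $$\widehat{\mathscr M}^{rls}(y)=\frac{\left\||(\widetilde K\otimes y^{\mathsf T}+\mathbf r^{\mathsf T}\otimes\widetilde S^{-1})\Phi_{\mathcal T_{nm}}|\,\mathrm{vec}_{\mathcal T}(|Q^{\mathsf T}|)+|\widetilde K||f|\right\|_\infty}{\|y\|_\infty},$$ $$\widehat{\mathscr C}^{rls}(y)=\left\|\mathbf D_y^\dagger|(\widetilde K\otimes y^{\mathsf T}+\mathbf r^{\mathsf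 T}\otimes\widetilde S^{-1})\Phi_{\mathcal T_{nm}}|\,\mathrm{vec}_{\mathcal T}(|Q^{\mathsf T}|)+\mathbf D_y^\dagger|\widetilde K||f|\right\|_\infty .$$
   Context: Notation: $\|\cdot\|_2$ is the Euclidean norm of a vector / spectral norm of a matrix, $\|\cdot\|_\infty$ the infinity norm, $\|\cdot\|_F$ the Frobenius norm. $|X|$ is the entrywise absolute value, and $X\le Y$ for matrices is entrywise. $\mathrm{vec}$ stacks columns, $\otimes$ is the Kronecker product. For a vector $v$, $\mathbf D_v$ is the diagonal matrix with diagonal $v$; $\dagger$ is the Moore-Penrose inverse. Quotients of vectors are entrywise, with $0/0=0$ and $a/0=\infty$ for $a\ne0$. Setting: $Q\in\mathbb R^{m\times n}$ ($m\ge n$) is a full rank Toeplitz matrix, $W\in\mathbb R^{m\times m}$ is symmetric positive definite, $\lambda>0$, $f\in\mathbb R^m$. The problem is equivalent to $\begin{bmatrix}W^{-1}&Q\\ Q^{\mathsf T}&-\lambda I_n\end{bmatrix}\begin{bmatrix}\mathbf r\\ y\end{bmatrix}=\begin{bmatrix}f\\ \mathbf 0\end{bmatrix}$. Toeplitz structure: $\mathcal T^{n\times m}$ is the space of $n\times m$ real Toeplitz matrices $T=[t_{j-i}]$, with $\mathrm{vec}_{\mathcal T}(T)=[t_{-n+1},\dots,t_0,\dots,t_{m-1}]^{\mathsf T}\in\mathbb R^{m+n-1}$. For $-n+1\le i\le m-1$, $\mathcal J_i$ is the $n\times m$ Toeplitz matrix with $t_i=1$ and all other $t_l=0$; $\Phi_{\mathcal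 T_{nm}}=[\mathrm{vec}(\mathcal J_{-n+1}),\dots,\mathrm{vec}(\mathcal J_{m-1})]$. $\mathfrak D_{\mathcal T_{nm}}$ is the diagonal matrix with positive diagonal such that $\|T\|_F=\|\mathfrak D_{\mathcal T_{nm}}\mathrm{vec}_{\mathcal T}(T)\|_2$ for all $T\in\mathcal T^{n\times m}$, i.e. its entry for $t_i$ is the square root of the number of positions $(r,s)$ of an $n\times m$ matrix with $s-r=i$. Definitions: for a Toeplitz perturbation $\Delta Q\in\mathbb R^{m\times n}$ (i.e. $\Delta Q^{\mathsf T}\in\mathcal T^{n\times m}$) and $\Delta f\in\mathbb R^m$, let $[(\mathbf r+\Delta\mathbf r)^{\mathsf T},(y+\Delta y)^{\mathsf T}]^{\mathsf T}$ be the unique solution (for small perturbations) of $\begin{bmatrix}W^{-1}&Q+\Delta Q\\ (Q+\Delta Q)^{\mathsf T}&-\lambda I_n\end{bmatrix}\begin{bmatrix}\mathbf r+\Delta\mathbf r\\ y+\Delta y\end{bmatrix}=\begin{bmatrix}f+\Delta f\\ \mathbf 0\end{bmatrix}$. Then, with suprema over such $\Delta Q,\Delta f$, $$\widehat{\mathscr K}^{rls}(y)=\lim_{\eta\to0}\sup\left\{\frac{\|\Delta y\|_2}{\eta\|y\|_2}:\|[\Delta Q\ \ \Delta f]\|_F\le\eta\|[Q\ \ f]\|_F\right\},$$ $$\widehat{\mathscr M}^{rls}(y)=\lim_{\eta\to0}\sup\left\{\frac{\|\Delta y\|_\infty}{\eta\|y\|_\infty}:|[\Delta Q\ \ \Delta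 f]|\le\eta|[Q\ \ f]|\right\},$$ $$\widehat{\mathscr C}^{rls}(y)=\lim_{\eta\to0}\sup\left\{\frac1\eta\left\|\frac{\Delta y}{y}\right\|_\infty:|[\Delta Q\ \ \Delta f]|\le\eta|[Q\ \ f]|\right\}.$$ *)

theory Defs
  imports
    "HOL-Library.Extended_Real"
    "Jordan_Normal_Form.Gauss_Jordan_Elimination"
    "Jordan_Normal_Form.DL_Rank"
begin

section \<open>Norms and entrywise operations\<close>

definition norm2_vec :: "real vec \<Rightarrow> real" where
  "norm2_vec v = sqrt (v \<bullet> v)"

definition norm_inf_vec :: "real vec \<Rightarrow> real" where
  "norm_inf_vec v = Max ((\<lambda>i. \<bar>v $ i\<bar>) ` {..<dim_vec v})"

definition norm_F :: "real mat \<Rightarrow> real" where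
  "norm_F A = sqrt (\<Sum>i<dim_row A. \<Sum>j<dim_col A. (A $$ (i, j))\<^sup>2)"

text \<open>The spectral norm, as the operator norm induced by the Euclidean norm.\<close>

definition norm2_mat :: "real mat \<Rightarrow> real" where
  "norm2_mat A = Sup ((\<lambda>x. norm2_vec (A *\<^sub>v x)) ` {x \<in> carrier_vec (dim_col A). norm2_vec x \<le> 1})"

definition abs_vec :: "real vec \<Rightarrow> real vec" where
  "abs_vec v = map_vec abs v"

definition abs_mat :: "real mat \<Rightarrow> real mat" where
  "abs_mat A = map_mat abs A"

definition le_mat :: "real mat \<Rightarrow> real mat \<Rightarrow> bool" where
  "le_mat A B \<longleftrightarrow> dim_row A = dim_row B \<and> dim_col A = dim_col B \<and>
     (\<forall>i<dim_row A. \<forall>j<dim_col A. A $$ (i, j) \<le> B $$ (i, j))"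

text \<open>Quotients with \<open>0/0 = 0\<close> and \<open>a/0 = \<infinity>\<close> for \<open>a \<noteq> 0\<close>, and the infinity norm of an
  entrywise quotient of vectors.\<close>

definition quot :: "real \<Rightarrow> real \<Rightarrow> ereal" where
  "quot a b = (if b \<noteq> 0 then ereal (a / b) else if a = 0 then 0 else \<infinity>)"

definition norm_inf_quot :: "real vec \<Rightarrow> real vec \<Rightarrow> ereal" where
  "norm_inf_quot u v = (SUP i\<in>{..<dim_vec v}. \<bar>quot (u $ i) (v $ i)\<bar>)"


section \<open>Matrix constructions\<close>

text \<open>\<^const>\<open>mat_inverse\<close> returns \<^const>\<open>None\<close> exactly for matrices that are not invertible.\<close>

definition mat_inv :: "real mat \<Rightarrow> real mat" where
  "mat_inv A = the (mat_inverse A)"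

text \<open>The Moore-Penrose inverse, characterised by the four Penrose equations.\<close>

definition pinv :: "real mat \<Rightarrow> real mat" where
  "pinv A = (THE X. X \<in> carrier_mat (dim_col A) (dim_row A) \<and>
     A * X * A = A \<and> X * A * X = X \<and>
     transpose_mat (A * X) = A * X \<and> transpose_mat (X * A) = X * A)"

definition diag_vec :: "real vec \<Rightarrow> real mat" where
  "diag_vec v = mat_diag (dim_vec v) (\<lambda>i. v $ i)"

text \<open>The block matrices \<open>[A B]\<close> and \<open>[A v]\<close>.\<close>

definition hcat :: "real mat \<Rightarrow> real mat \<Rightarrow> real mat" where
  "hcat A B = mat_of_cols (dim_row A) (cols A @ cols B)"

definition hcat_vec :: "real mat \<Rightarrow> real vec \<Rightarrow> real mat" where
  "hcat_vec A v = mat_of_cols (dim_row A) (cols A @ [v])"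

definition kron :: "real mat \<Rightarrow> real mat \<Rightarrow> real mat" where
  "kron A B = mat (dim_row A * dim_row B) (dim_col A * dim_col B)
     (\<lambda>(i, j). A $$ (i div dim_row B, j div dim_col B) * B $$ (i mod dim_row B, j mod dim_col B))"

text \<open>Column stacking: entry \<open>(i, j)\<close> is put at position \<open>j * dim_row A + i\<close>.\<close>

definition vec_stack :: "real mat \<Rightarrow> real vec" where
  "vec_stack A = vec (dim_row A * dim_col A) (\<lambda>k. A $$ (k mod dim_row A, k div dim_row A))"

definition sym_pos_def :: "real mat \<Rightarrow> bool" where
  "sym_pos_def A \<longleftrightarrow> square_mat A \<and> transpose_mat A = A \<and>
     (\<forall>x\<in>carrier_vec (dim_row A). x \<noteq> 0\<^sub>v (dim_row A) \<longrightarrow> x \<bullet> (A *\<^sub>v x) > 0)"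

text \<open>\<open>X\<close> is the (unique) symmetric positive definite square root of \<open>A\<close>.\<close>

definition is_spd_sqrt :: "real mat \<Rightarrow> real mat \<Rightarrow> bool" where
  "is_spd_sqrt X A \<longleftrightarrow> sym_pos_def X \<and> X * X = A"


section \<open>Toeplitz matrices\<close>

definition toeplitz_mat :: "nat \<Rightarrow> nat \<Rightarrow> (int \<Rightarrow> real) \<Rightarrow> real mat" where
  "toeplitz_mat n m t = mat n m (\<lambda>(i, j). t (int j - int i))"

definition toeplitz_space :: "nat \<Rightarrow> nat \<Rightarrow> real mat set" where
  "toeplitz_space n m = range (toeplitz_mat n m)"

text \<open>
  The diagonals of an \<open>n \<times> m\<close> matrix are numbered \<open>-n+1, \<dots>, m-1\<close>; diagonal \<open>l\<close> is the one with
  \<open>column - row = l\<close>, and vectors indexed by diagonals store it at position \<open>k = l + n - 1\<close>.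
\<close>

definition diag_no :: "nat \<Rightarrow> nat \<Rightarrow> int" where
  "diag_no n k = int k - (int n - 1)"

text \<open>
  Diagonal \<open>diag_no n k\<close> is read off at its topmost leftmost position, which lies in the first
  column if \<open>k \<le> n - 1\<close> and in the first row if \<open>k \<ge> n - 1\<close> (note the truncated subtractions).
\<close>

definition vec_T :: "real mat \<Rightarrow> real vec" where
  "vec_T A = vec (dim_col A + dim_row A - 1)
     (\<lambda>k. A $$ (dim_row A - 1 - k, k - (dim_row A - 1)))"

definition J_T :: "nat \<Rightarrow> nat \<Rightarrow> int \<Rightarrow> real mat" where
  "J_T n m l = toeplitz_mat n m (\<lambda>l'. if l' = l then 1 else 0)"

definition Phi_T :: "nat \<Rightarrow> nat \<Rightarrow> real mat" where
  "Phi_T n m = mat_of_cols (n * m)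
     (map (\<lambda>k. vec_stack (J_T n m (diag_no n k))) [0..<m + n - 1])"

text \<open>The weights for which the Frobenius norm of a Toeplitz matrix \<open>A\<close> equals the Euclidean norm
  of \<open>D_T n m *\<^sub>v vec_T A\<close>: square roots of the lengths of the diagonals.\<close>

definition D_T :: "nat \<Rightarrow> nat \<Rightarrow> real mat" where
  "D_T n m = mat_diag (m + n - 1)
     (\<lambda>k. sqrt (card {(i, j). i < n \<and> j < m \<and> int j - int i = diag_no n k}))"


section \<open>The regularized least-squares problem and its structured condition numbers\<close>

definition rls_objective :: "real mat \<Rightarrow> real \<Rightarrow> real mat \<Rightarrow> real vec \<Rightarrow> real vec \<Rightarrow> real" where
  "rls_objective Wh lam Q f z =
     (norm2_vec (((Wh * Q) @\<^sub>r (sqrt lam \<cdot>\<^sub>m 1\<^sub>m (dim_col Q))) *\<^sub>v z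
        - ((Wh *\<^sub>v f) @\<^sub>v 0\<^sub>v (dim_col Q))))\<^sup>2"

definition augmented_mat :: "real mat \<Rightarrow> real \<Rightarrow> real mat \<Rightarrow> real mat" where
  "augmented_mat W lam Q =
     four_block_mat (mat_inv W) Q (transpose_mat Q) ((- lam) \<cdot>\<^sub>m 1\<^sub>m (dim_col Q))"

text \<open>
  \<open>(dr, dy)\<close> is the change of the solution \<open>(r, y)\<close> of the augmented system caused by the Toeplitz
  perturbation \<open>dQ\<close> of \<open>Q\<close> and the perturbation \<open>df\<close> of \<open>f\<close>. For symmetric positive definite
  \<open>W\<close> and \<open>lam > 0\<close> the augmented matrix is nonsingular, so \<open>dQ\<close> and \<open>df\<close> determine \<open>dr\<close> and \<open>dy\<close>.
\<close>

definition rls_perturbation ::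
  "real mat \<Rightarrow> real \<Rightarrow> real mat \<Rightarrow> real vec \<Rightarrow> real vec \<Rightarrow> real vec \<Rightarrow>
   real mat \<Rightarrow> real vec \<Rightarrow> real vec \<Rightarrow> real vec \<Rightarrow> bool" where
  "rls_perturbation W lam Q f r y dQ df dr dy \<longleftrightarrow>
     dQ \<in> carrier_mat (dim_row Q) (dim_col Q) \<and>
     transpose_mat dQ \<in> toeplitz_space (dim_col Q) (dim_row Q) \<and>
     df \<in> carrier_vec (dim_row Q) \<and>
     dr \<in> carrier_vec (dim_row Q) \<and> dy \<in> carrier_vec (dim_col Q) \<and>
     augmented_mat W lam (Q + dQ) *\<^sub>v ((r + dr) @\<^sub>v (y + dy)) = (f + df) @\<^sub>v 0\<^sub>v (dim_col Q)"

text \<open>Suprema are taken in the extended reals; each condition number is the limit of the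
  corresponding supremum as \<open>\<eta>\<close> tends to 0 from above.\<close>

definition normwise_sup ::
  "real mat \<Rightarrow> real \<Rightarrow> real mat \<Rightarrow> real vec \<Rightarrow> real vec \<Rightarrow> real vec \<Rightarrow> real \<Rightarrow> ereal" where
  "normwise_sup W lam Q f r y \<eta> =
     Sup {ereal (norm2_vec dy / (\<eta> * norm2_vec y)) | dQ df dr dy.
       rls_perturbation W lam Q f r y dQ df dr dy \<and>
       norm_F (hcat_vec dQ df) \<le> \<eta> * norm_F (hcat_vec Q f)}"

definition mixed_sup ::
  "real mat \<Rightarrow> real \<Rightarrow> real mat \<Rightarrow> real vec \<Rightarrow> real vec \<Rightarrow> real vec \<Rightarrow> real \<Rightarrow> ereal" where
  "mixed_sup W lam Q f r y \<eta> =
     Sup {ereal (norm_inf_vec dy / (\<eta> * norm_inf_vec y)) | dQ df dr dy.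
       rls_perturbation W lam Q f r y dQ df dr dy \<and>
       le_mat (abs_mat (hcat_vec dQ df)) (\<eta> \<cdot>\<^sub>m abs_mat (hcat_vec Q f))}"

definition componentwise_sup ::
  "real mat \<Rightarrow> real \<Rightarrow> real mat \<Rightarrow> real vec \<Rightarrow> real vec \<Rightarrow> real vec \<Rightarrow> real \<Rightarrow> ereal" where
  "componentwise_sup W lam Q f r y \<eta> =
     Sup {ereal (1 / \<eta>) * norm_inf_quot dy y | dQ df dr dy.
       rls_perturbation W lam Q f r y dQ df dr dy \<and>
       le_mat (abs_mat (hcat_vec dQ df)) (\<eta> \<cdot>\<^sub>m abs_mat (hcat_vec Q f))}"

definition normwise_cond ::
  "real mat \<Rightarrow> real \<Rightarrow> real mat \<Rightarrow> real vec \<Rightarrow> real vec \<Rightarrow> real vec \<Rightarrow> ereal" where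
  "normwise_cond W lam Q f r y = Lim (at_right 0) (normwise_sup W lam Q f r y)"

definition mixed_cond ::
  "real mat \<Rightarrow> real \<Rightarrow> real mat \<Rightarrow> real vec \<Rightarrow> real vec \<Rightarrow> real vec \<Rightarrow> ereal" where
  "mixed_cond W lam Q f r y = Lim (at_right 0) (mixed_sup W lam Q f r y)"

definition componentwise_cond ::
  "real mat \<Rightarrow> real \<Rightarrow> real mat \<Rightarrow> real vec \<Rightarrow> real vec \<Rightarrow> real vec \<Rightarrow> ereal" where
  "componentwise_cond W lam Q f r y = Lim (at_right 0) (componentwise_sup W lam Q f r y)"

end

theory Submission
  imports Defs "HOL-Analysis.L2_Norm"
begin

text \<open>
  The minimizer \<open>y\<close> satisfies the normal equation \<open>Q\<^sup>T r = \<lambda> y\<close> (\<open>rls_minimizer_normal_equation\<close>).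
  Subtracting it, and the definition of \<open>r\<close>, from the perturbed augmented system and eliminating
  \<open>dr\<close> from the left-hand side gives the exact identity (\<open>perturbation_equations\<close>)
  \<open>dy = K (df - dQ (y + dy)) - S\<^sup>-\<^sup>1 dQ\<^sup>T (r + dr)\<close>,
  whose first-order part \<open>K df - K dQ y - S\<^sup>-\<^sup>1 dQ\<^sup>T r\<close> equals \<open>K df - B t\<close>, where \<open>t\<close> lists the
  diagonals of the Toeplitz matrix \<open>dQ\<^sup>T\<close> (\<open>B_mult_vec_T\<close>). Since \<open>\<lambda> I + X\<^sup>T W X\<close> is positive definite
  for every \<open>X\<close>, each perturbation of the data, large or small, does have a solution
  (\<open>rls_perturbation_exists\<close>).

  The identity also bounds its own remainder, without any appeal to the continuity of matrix
  inversion: it yields \<open>x \<le> e c (1 + x)\<close> for the sum \<open>x\<close> of the norms of \<open>dr\<close> and \<open>dy\<close>, if \<open>e\<close> bounds the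
  data perturbation, hence \<open>x = O(e)\<close> for small \<open>e\<close>, and then the remainder is \<open>O(e\<^sup>2)\<close>
  (\<open>first_order_remainder\<close>). After division by \<open>\<eta>\<close>, the supremum of any seminorm of \<open>dy\<close> over the
  perturbations of size \<open>\<eta>\<close> therefore tends to the supremum of that seminorm of the linear part over the
  perturbations of size \<open>1\<close> (\<open>condition_number_limit\<close>).

  It remains to compute this supremum. In the normwise case, \<open>x = (D t, df)\<close> are coordinates of the
  pair \<open>(dQ, df)\<close> in which the Frobenius norm is Euclidean, and the linear part is
  \<open>- [B D\<^sup>-\<^sup>1, - K] x\<close>, so that the supremum is a spectral norm (\<open>normwise_limit\<close>). For entrywise constraints,
  the \<open>i\<close>-th entry of the linear part is largest when all summands have the same sign, which gives
  the \<open>i\<close>-th entry of \<open>|B| |q| + |K| |f|\<close>, where \<open>q\<close> lists the diagonals of \<open>Q\<^sup>T\<close>. Taking the maximum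
  over \<open>i\<close> with weight \<open>1\<close> divided by the maximum norm of \<open>y\<close>, or \<open>1 / |y i|\<close>, gives the mixed and
  the componentwise condition number (\<open>entrywise_limit\<close>).
\<close>

section \<open>Matrices, inverses and positive definiteness\<close>

lemma vec_add_eq_iff_diff:
  "(a :: 'a :: ab_group_add vec) \<in> carrier_vec k \<Longrightarrow> b \<in> carrier_vec k \<Longrightarrow> c \<in> carrier_vec k \<Longrightarrow>
    a + b = c \<longleftrightarrow> a = c - b"
  by (auto simp: vec_eq_iff algebra_simps)

lemma vec_add_left_cancel:
  "(a :: 'a :: ab_group_add vec) \<in> carrier_vec k \<Longrightarrow> b \<in> carrier_vec k \<Longrightarrow> c \<in> carrier_vec k \<Longrightarrow>
    a + b = a + c \<longleftrightarrow> b = c"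
  by (auto simp: vec_eq_iff)

lemma vec_add_uminus_eq_0_iff:
  "(a :: 'a :: ab_group_add vec) \<in> carrier_vec k \<Longrightarrow> b \<in> carrier_vec k \<Longrightarrow> a + - b = 0\<^sub>v k \<longleftrightarrow> a = b"
  by (auto simp: vec_eq_iff)

lemma vec_add_diff_cancel:
  "(a :: 'a :: ab_group_add vec) \<in> carrier_vec k \<Longrightarrow> b \<in> carrier_vec k \<Longrightarrow> a + b - b = a"
  by (auto simp: vec_eq_iff)

lemma vec_uminus_add:
  "(a :: 'a :: ab_group_add vec) \<in> carrier_vec k \<Longrightarrow> b \<in> carrier_vec k \<Longrightarrow> - (a + b) = - a - b"
  by (auto simp: vec_eq_iff)

lemma mult_mat_vec_uminus:
  "(A :: 'a :: ring mat) \<in> carrier_mat a b \<Longrightarrow> v \<in> carrier_vec b \<Longrightarrow> A *\<^sub>v (- v) = - (A *\<^sub>v v)"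
  by (intro eq_vecI) auto

lemma mult_mat_vec_nth:
  assumes "A \<in> carrier_mat a b" "x \<in> carrier_vec b" "i < a"
  shows "(A *\<^sub>v x) $ i = (\<Sum>j<b. A $$ (i, j) * x $ j)"
  using assms by (auto simp: scalar_prod_def atLeast0LessThan intro!: sum.cong)

lemma mat_inv_of_trivial_kernel:
  assumes A: "A \<in> carrier_mat k k"
    and ker: "\<And>x. x \<in> carrier_vec k \<Longrightarrow> A *\<^sub>v x = 0\<^sub>v k \<Longrightarrow> x = 0\<^sub>v k"
  shows "mat_inv A \<in> carrier_mat k k" "A * mat_inv A = 1\<^sub>m k" "mat_inv A * A = 1\<^sub>m k"
proof -
  have "det A \<noteq> 0"
    using det_0_iff_vec_prod_zero_field[OF A] ker by blast
  then have "A \<in> Units (ring_mat TYPE(real) k ())"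
    by (rule det_non_zero_imp_unit[OF A])
  then obtain X where "mat_inverse A = Some X"
    using mat_inverse(1)[OF A, of "()"] by (cases "mat_inverse A") auto
  then show "mat_inv A \<in> carrier_mat k k" "A * mat_inv A = 1\<^sub>m k" "mat_inv A * A = 1\<^sub>m k"
    using mat_inverse(2)[OF A] by (auto simp: mat_inv_def)
qed

lemma mat_inv_unique:
  assumes A: "A \<in> carrier_mat k k" and X: "X \<in> carrier_mat k k" and XA: "X * A = 1\<^sub>m k"
  shows "mat_inv A = X"
proof -
  have "x = 0\<^sub>v k" if x: "x \<in> carrier_vec k" and "A *\<^sub>v x = 0\<^sub>v k" for x
  proof -
    have "x = (X * A) *\<^sub>v x" using XA x by simp
    also have "\<dots> = X *\<^sub>v (A *\<^sub>v x)" by (rule assoc_mult_mat_vec[OF X A x])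
    also have "\<dots> = 0\<^sub>v k" using that X by (auto simp: scalar_prod_def)
    finally show ?thesis .
  qed
  note inv = mat_inv_of_trivial_kernel[OF A this]
  have "mat_inv A = (X * A) * mat_inv A" using XA inv(1) by simp
  also have "\<dots> = X * (A * mat_inv A)" by (rule assoc_mult_mat[OF X A inv(1)])
  also have "\<dots> = X" using inv(2) X by simp
  finally show ?thesis .
qed

lemma mat_inv_mat_diag:
  assumes "\<And>i. i < k \<Longrightarrow> d i \<noteq> 0"
  shows "mat_inv (mat_diag k d) = mat_diag k (\<lambda>i. 1 / d i)"
proof (rule mat_inv_unique[of _ k])
  show "mat_diag k (\<lambda>i. 1 / d i) * mat_diag k d = 1\<^sub>m k"
    unfolding mat_diag_diag using assms by (auto simp: mat_diag_def one_mat_def)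
qed auto

lemma mat_diag_mult_vec_nth:
  assumes x: "x \<in> carrier_vec k" and i: "i < k"
  shows "(mat_diag k d *\<^sub>v x) $ i = d i * (x $ i :: real)"
proof -
  have "(mat_diag k d *\<^sub>v x) $ i = (\<Sum>j<k. mat_diag k d $$ (i, j) * x $ j)"
    by (rule mult_mat_vec_nth[OF mat_diag_dim x i])
  also have "\<dots> = (\<Sum>j<k. if j = i then d i * x $ i else 0)"
    using i by (intro sum.cong) (auto simp: mat_diag_def)
  also have "\<dots> = d i * x $ i"
    using i by (subst sum.delta) auto
  finally show ?thesis .
qed

lemma scalar_prod_self_nonneg: "0 \<le> (v :: real vec) \<bullet> v"
  by (auto simp: scalar_prod_def intro!: sum_nonneg)

lemma scalar_prod_self_eq_0:
  assumes "(v :: real vec) \<in> carrier_vec k" "v \<bullet> v = 0"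
  shows "v = 0\<^sub>v k"
  using assms conjugate_square_eq_0_vec[of v k] by simp

lemma sym_pos_def_nonneg:
  assumes "sym_pos_def A" "A \<in> carrier_mat k k" "x \<in> carrier_vec k"
  shows "0 \<le> x \<bullet> (A *\<^sub>v x)"
proof (cases "x = 0\<^sub>v k")
  case True
  then show ?thesis using assms by simp
next
  case False
  then show ?thesis using assms by (auto simp: sym_pos_def_def less_imp_le)
qed

lemma sym_pos_def_inverse:
  assumes A: "A \<in> carrier_mat k k" and spd: "sym_pos_def A"
  shows "mat_inv A \<in> carrier_mat k k" "A * mat_inv A = 1\<^sub>m k" "mat_inv A * A = 1\<^sub>m k"
proof -
  have "x = 0\<^sub>v k" if "x \<in> carrier_vec k" "A *\<^sub>v x = 0\<^sub>v k" for x
  proof (rule ccontr)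
    assume "x \<noteq> 0\<^sub>v k"
    then have "x \<bullet> (A *\<^sub>v x) > 0"
      using spd A that(1) by (auto simp: sym_pos_def_def)
    with that show False by simp
  qed
  from mat_inv_of_trivial_kernel[OF A this]
  show "mat_inv A \<in> carrier_mat k k" "A * mat_inv A = 1\<^sub>m k" "mat_inv A * A = 1\<^sub>m k"
    by auto
qed

lemma pinv_diag_vec:
  assumes y: "y \<in> carrier_vec n" and nz: "\<And>i. i < n \<Longrightarrow> y $ i \<noteq> 0"
  shows "pinv (diag_vec y) = mat_diag n (\<lambda>i. 1 / y $ i)"
proof -
  let ?A = "mat_diag n (\<lambda>i. y $ i)" and ?V = "mat_diag n (\<lambda>i. 1 / y $ i)"
  have A: "?A \<in> carrier_mat n n" and V: "?V \<in> carrier_mat n n" by simp_all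
  have AV: "?A * ?V = 1\<^sub>m n" and VA: "?V * ?A = 1\<^sub>m n"
    unfolding mat_diag_diag using nz by (auto simp: mat_diag_def one_mat_def intro!: cong_mat)
  have "diag_vec y = ?A" using y by (simp add: diag_vec_def)
  moreover have "(THE X. X \<in> carrier_mat (dim_col ?A) (dim_row ?A) \<and>
     ?A * X * ?A = ?A \<and> X * ?A * X = X \<and>
     transpose_mat (?A * X) = ?A * X \<and> transpose_mat (X * ?A) = X * ?A) = ?V"
  proof (rule the_equality)
    show "?V \<in> carrier_mat (dim_col ?A) (dim_row ?A) \<and>
     ?A * ?V * ?A = ?A \<and> ?V * ?A * ?V = ?V \<and>
     transpose_mat (?A * ?V) = ?A * ?V \<and> transpose_mat (?V * ?A) = ?V * ?A"
      unfolding AV VA using carrier_matD[OF A] carrier_matD[OF V] by simp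
  next
    fix X assume X': "X \<in> carrier_mat (dim_col ?A) (dim_row ?A) \<and>
     ?A * X * ?A = ?A \<and> X * ?A * X = X \<and>
     transpose_mat (?A * X) = ?A * X \<and> transpose_mat (X * ?A) = X * ?A"
    then have X: "X \<in> carrier_mat n n" and AXA: "?A * X * ?A = ?A" using A by auto
    have AX: "?A * X \<in> carrier_mat n n" by (rule mult_carrier_mat[OF A X])
    have "?A * X = ?A * X * (?A * ?V)" unfolding AV right_mult_one_mat[OF AX] ..
    also have "\<dots> = ?A * X * ?A * ?V" by (rule assoc_mult_mat[OF AX A V, symmetric])
    also have "\<dots> = 1\<^sub>m n" unfolding AXA AV ..
    finally have "?V * (?A * X) = ?V" by (simp only: right_mult_one_mat[OF V])
    moreover have "?V * (?A * X) = (?V * ?A) * X" by (rule assoc_mult_mat[OF V A X, symmetric])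
    ultimately show "X = ?V" unfolding VA left_mult_one_mat[OF X] by metis
  qed
  ultimately show ?thesis by (simp add: pinv_def)
qed

section \<open>Norms\<close>

text \<open>Sums of the absolute values of the entries. All remainder estimates use these norms: they are
  compatible with each other and dominate the Euclidean and the maximum norm.\<close>

definition norm1_vec :: "real vec \<Rightarrow> real" where
  "norm1_vec v = (\<Sum>i<dim_vec v. \<bar>v $ i\<bar>)"

definition norm1_mat :: "real mat \<Rightarrow> real" where
  "norm1_mat A = (\<Sum>i<dim_row A. \<Sum>j<dim_col A. \<bar>A $$ (i, j)\<bar>)"

lemma norm1_vec_nonneg [simp]: "0 \<le> norm1_vec v"
  by (simp add: norm1_vec_def sum_nonneg)

lemma norm1_mat_nonneg [simp]: "0 \<le> norm1_mat A"
  by (simp add: norm1_mat_def sum_nonneg)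

lemma abs_nth_le_norm1_vec: "i < dim_vec v \<Longrightarrow> \<bar>v $ i\<bar> \<le> norm1_vec v"
  unfolding norm1_vec_def by (rule member_le_sum) auto

lemma norm1_vec_add_le:
  "u \<in> carrier_vec k \<Longrightarrow> v \<in> carrier_vec k \<Longrightarrow> norm1_vec (u + v) \<le> norm1_vec u + norm1_vec v"
proof -
  assume "u \<in> carrier_vec k" "v \<in> carrier_vec k"
  moreover have "(\<Sum>i<k. \<bar>u $ i + v $ i\<bar>) \<le> (\<Sum>i<k. \<bar>u $ i\<bar> + \<bar>v $ i\<bar>)"
    by (intro sum_mono abs_triangle_ineq)
  ultimately show ?thesis by (simp add: norm1_vec_def sum.distrib)
qed

lemma norm1_vec_diff_le:
  "u \<in> carrier_vec k \<Longrightarrow> v \<in> carrier_vec k \<Longrightarrow> norm1_vec (u - v) \<le> norm1_vec u + norm1_vec v"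
proof -
  assume "u \<in> carrier_vec k" "v \<in> carrier_vec k"
  moreover have "(\<Sum>i<k. \<bar>u $ i - v $ i\<bar>) \<le> (\<Sum>i<k. \<bar>u $ i\<bar> + \<bar>v $ i\<bar>)"
    by (intro sum_mono abs_triangle_ineq4)
  ultimately show ?thesis by (simp add: norm1_vec_def sum.distrib)
qed

lemma norm1_vec_diff_commute:
  "u \<in> carrier_vec k \<Longrightarrow> v \<in> carrier_vec k \<Longrightarrow> norm1_vec (u - v) = norm1_vec (v - u)"
  using abs_minus_commute[of "u $ i" "v $ i" for i] by (simp add: norm1_vec_def)

lemma norm1_vec_uminus [simp]: "norm1_vec (- v) = norm1_vec v"
  by (auto simp: norm1_vec_def)

lemma norm1_mat_transpose: "norm1_mat (transpose_mat A) = norm1_mat A"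
  using sum.swap[of "\<lambda>i j. \<bar>A $$ (i, j)\<bar>" "{..<dim_col A}" "{..<dim_row A}"]
  by (simp add: norm1_mat_def)

lemma norm1_mult_mat_vec_le:
  assumes A: "A \<in> carrier_mat a b" and x: "x \<in> carrier_vec b"
  shows "norm1_vec (A *\<^sub>v x) \<le> norm1_mat A * norm1_vec x"
proof -
  have "\<bar>(A *\<^sub>v x) $ i\<bar> \<le> (\<Sum>j<b. \<bar>A $$ (i, j)\<bar>) * norm1_vec x" if "i < a" for i
  proof -
    have "\<bar>(A *\<^sub>v x) $ i\<bar> \<le> (\<Sum>j<b. \<bar>A $$ (i, j) * x $ j\<bar>)"
      unfolding mult_mat_vec_nth[OF A x that] by (rule sum_abs)
    also have "\<dots> \<le> (\<Sum>j<b. \<bar>A $$ (i, j)\<bar> * norm1_vec x)"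
      using x by (auto simp: abs_mult intro!: sum_mono mult_left_mono abs_nth_le_norm1_vec)
    finally show ?thesis by (simp add: sum_distrib_right)
  qed
  then have "(\<Sum>i<a. \<bar>(A *\<^sub>v x) $ i\<bar>) \<le> (\<Sum>i<a. (\<Sum>j<b. \<bar>A $$ (i, j)\<bar>) * norm1_vec x)"
    by (intro sum_mono) auto
  then show ?thesis
    using A by (simp add: norm1_vec_def[of "A *\<^sub>v x"] norm1_mat_def sum_distrib_right)
qed

lemma norm2_vec_L2: "norm2_vec v = L2_set (\<lambda>i. v $ i) {..<dim_vec v}"
  by (simp add: norm2_vec_def L2_set_def scalar_prod_def atLeast0LessThan power2_eq_square)

lemma norm2_vec_nonneg [simp]: "0 \<le> norm2_vec v"
  by (simp add: norm2_vec_L2)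

lemma norm2_vec_le_norm1_vec: "norm2_vec v \<le> norm1_vec v"
  unfolding norm2_vec_L2 norm1_vec_def by (rule L2_set_le_sum_abs)

lemma norm2_vec_add_le:
  "u \<in> carrier_vec k \<Longrightarrow> v \<in> carrier_vec k \<Longrightarrow> norm2_vec (u + v) \<le> norm2_vec u + norm2_vec v"
  using L2_set_triangle_ineq[of "\<lambda>i. u $ i" "\<lambda>i. v $ i" "{..<k}"]
  by (simp add: norm2_vec_L2 L2_set_def)

lemma norm2_vec_smult: "norm2_vec (c \<cdot>\<^sub>v v) = \<bar>c\<bar> * norm2_vec v"
proof -
  have "(c \<cdot>\<^sub>v v) \<bullet> (c \<cdot>\<^sub>v v) = c\<^sup>2 * (v \<bullet> v)"
    by (simp add: scalar_prod_def sum_distrib_left power2_eq_square ac_simps)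
  then show ?thesis by (simp add: norm2_vec_def real_sqrt_mult)
qed

lemma norm2_vec_uminus: "norm2_vec (- v) = norm2_vec v"
  by (simp add: norm2_vec_L2 L2_set_def)

lemma norm2_vec_pos:
  assumes "v \<in> carrier_vec k" "v \<noteq> 0\<^sub>v k"
  shows "0 < norm2_vec v"
proof -
  have "v \<bullet> v \<noteq> 0" using scalar_prod_self_eq_0[OF assms(1)] assms(2) by blast
  then have "0 < v \<bullet> v" using scalar_prod_self_nonneg[of v] by linarith
  then show ?thesis by (simp add: norm2_vec_def)
qed

text \<open>The crude constant suffices, as it is only used to bound the set that defines the spectral
  norm.\<close>

lemma norm1_vec_le_norm2_vec:
  assumes "v \<in> carrier_vec k"
  shows "norm1_vec v \<le> real k * norm2_vec v"
proof -
  have "\<bar>v $ i\<bar> \<le> norm2_vec v" if "i < k" for i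
  proof -
    have "\<bar>v $ i\<bar> = L2_set (\<lambda>i. v $ i) {i}" by simp
    also have "\<dots> \<le> norm2_vec v" unfolding norm2_vec_L2 L2_set_def using that assms
      by (intro real_sqrt_le_mono sum_mono2) auto
    finally show ?thesis .
  qed
  then have "(\<Sum>i<k. \<bar>v $ i\<bar>) \<le> (\<Sum>i<k. norm2_vec v)" by (intro sum_mono) auto
  then show ?thesis using assms by (simp add: norm1_vec_def)
qed

lemma norm2_mat_bdd_above:
  "bdd_above ((\<lambda>x. norm2_vec (A *\<^sub>v x)) ` {x \<in> carrier_vec (dim_col A). norm2_vec x \<le> 1})"
proof (rule bdd_aboveI2)
  fix x :: "real vec"
  assume x: "x \<in> {x \<in> carrier_vec (dim_col A). norm2_vec x \<le> 1}"
  have "norm2_vec (A *\<^sub>v x) \<le> norm1_mat A * norm1_vec x"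
    using norm2_vec_le_norm1_vec norm1_mult_mat_vec_le[of A "dim_row A" "dim_col A" x] x
    by (auto intro: order_trans)
  also have "\<dots> \<le> norm1_mat A * real (dim_col A)"
  proof (rule mult_left_mono)
    show "norm1_vec x \<le> real (dim_col A)"
      using norm1_vec_le_norm2_vec[of x "dim_col A"] mult_left_mono[of "norm2_vec x" 1 "real (dim_col A)"] x
      by auto
  qed simp
  finally show "norm2_vec (A *\<^sub>v x) \<le> norm1_mat A * real (dim_col A)" .
qed

lemma norm2_mat_mult_le:
  assumes A: "A \<in> carrier_mat a b" and x: "x \<in> carrier_vec b"
  shows "norm2_vec (A *\<^sub>v x) \<le> norm2_mat A * norm2_vec x"
proof (cases "x = 0\<^sub>v b")
  case True
  then have "A *\<^sub>v x = 0\<^sub>v a" using A by (auto simp: scalar_prod_def)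
  then show ?thesis using True by (simp add: norm2_vec_def)
next
  case False
  then have pos: "0 < norm2_vec x" using norm2_vec_pos x by blast
  let ?u = "(1 / norm2_vec x) \<cdot>\<^sub>v x"
  have "norm2_vec (A *\<^sub>v ?u) \<le> norm2_mat A"
    unfolding norm2_mat_def
    using A x pos by (intro cSUP_upper norm2_mat_bdd_above) (auto simp: norm2_vec_smult)
  moreover have "A *\<^sub>v ?u = (1 / norm2_vec x) \<cdot>\<^sub>v (A *\<^sub>v x)"
    by (rule mult_mat_vec[OF A x])
  ultimately show ?thesis using pos by (simp add: norm2_vec_smult field_simps)
qed

lemma norm2_mat_nonneg: "0 \<le> norm2_mat A"
proof -
  have "norm2_vec (A *\<^sub>v 0\<^sub>v (dim_col A)) \<le> norm2_mat A"
    unfolding norm2_mat_def by (intro cSUP_upper norm2_mat_bdd_above) (simp add: norm2_vec_def)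
  then show ?thesis using norm2_vec_nonneg order_trans by blast
qed

lemma norm2_mat_approx:
  assumes "0 < e"
  obtains x where "x \<in> carrier_vec (dim_col A)" "norm2_vec x \<le> 1"
    "norm2_mat A - e < norm2_vec (A *\<^sub>v x)"
proof -
  have ne: "(\<lambda>x. norm2_vec (A *\<^sub>v x)) ` {x \<in> carrier_vec (dim_col A). norm2_vec x \<le> 1} \<noteq> {}"
    by (auto simp: norm2_vec_def intro!: exI[of _ "0\<^sub>v (dim_col A)"])
  have "norm2_mat A - e < norm2_mat A" using assms by simp
  from this[unfolded norm2_mat_def[of A] less_cSup_iff[OF ne norm2_mat_bdd_above]]
  show ?thesis using that by (auto simp: norm2_mat_def)
qed

lemma abs_nth_le_norm_inf_vec: "v \<in> carrier_vec k \<Longrightarrow> i < k \<Longrightarrow> \<bar>v $ i\<bar> \<le> norm_inf_vec v"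
  unfolding norm_inf_vec_def by (rule Max_ge) auto

lemma norm_inf_vec_attained:
  assumes "v \<in> carrier_vec k" "0 < k"
  shows "\<exists>i<k. norm_inf_vec v = \<bar>v $ i\<bar>"
proof -
  have "norm_inf_vec v \<in> (\<lambda>i. \<bar>v $ i\<bar>) ` {..<dim_vec v}"
    unfolding norm_inf_vec_def using assms by (intro Max_in) auto
  then show ?thesis using assms by auto
qed

lemma abs_nth_le_norm_F:
  assumes A: "A \<in> carrier_mat a b" and i: "i < a" and j: "j < b"
  shows "\<bar>A $$ (i, j)\<bar> \<le> norm_F A"
proof -
  have "(A $$ (i, j))\<^sup>2 \<le> (\<Sum>j<b. (A $$ (i, j))\<^sup>2)"
    using j by (intro member_le_sum[of j "{..<b}" "\<lambda>j. (A $$ (i, j))\<^sup>2"]) auto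
  also have "\<dots> \<le> (\<Sum>i<a. \<Sum>j<b. (A $$ (i, j))\<^sup>2)"
    using i by (intro member_le_sum[of i "{..<a}" "\<lambda>i. \<Sum>j<b. (A $$ (i, j))\<^sup>2"]) (auto intro: sum_nonneg)
  finally have "sqrt ((A $$ (i, j))\<^sup>2) \<le> norm_F A"
    using A unfolding norm_F_def by (intro real_sqrt_le_mono) auto
  then show ?thesis by simp
qed

lemma norm_F_nonneg: "0 \<le> norm_F A"
  by (simp add: norm_F_def sum_nonneg)

section \<open>Toeplitz matrices and Kronecker products\<close>

lemma sum_div_mod:
  assumes "0 < (b :: nat)"
  shows "(\<Sum>p<a * b. g (p div b) (p mod b)) = (\<Sum>i<a. \<Sum>j<b. g i j)"
proof -
  have "(\<Sum>p<a * b. g (p div b) (p mod b)) = (\<Sum>i<a. \<Sum>p = i * b..<i * b + b. g (p div b) (p mod b))"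
    by (rule sum.nat_group[symmetric])
  also have "\<dots> = (\<Sum>i<a. \<Sum>j<b. g i j)"
  proof (rule sum.cong[OF refl])
    fix i
    have "(\<Sum>p = i * b..<i * b + b. g (p div b) (p mod b))
        = (\<Sum>j = 0..<b. g ((j + i * b) div b) ((j + i * b) mod b))"
      using sum.shift_bounds_nat_ivl[of "\<lambda>p. g (p div b) (p mod b)" 0 "i * b" b] by (simp add: add.commute)
    also have "\<dots> = (\<Sum>j<b. g i j)"
      using assms by (intro sum.cong) auto
    finally show "(\<Sum>p = i * b..<i * b + b. g (p div b) (p mod b)) = (\<Sum>j<b. g i j)" .
  qed
  finally show ?thesis .
qed

lemma vec_stack_carrier: "A \<in> carrier_mat n m \<Longrightarrow> vec_stack A \<in> carrier_vec (m * n)"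
  by (simp add: vec_stack_def mult.commute)

lemma kron_row_right_mult_vec_stack:
  assumes P: "P \<in> carrier_mat a m" and y: "y \<in> carrier_vec n" and A: "A \<in> carrier_mat n m" and n: "0 < n"
  shows "kron P (mat_of_row y) *\<^sub>v vec_stack A = P *\<^sub>v (transpose_mat A *\<^sub>v y)"
proof (rule eq_vecI)
  fix k assume "k < dim_vec (P *\<^sub>v (transpose_mat A *\<^sub>v y))"
  then have k: "k < a" using P by simp
  have K: "kron P (mat_of_row y) \<in> carrier_mat a (m * n)"
    using P y by (simp add: kron_def)
  have "(kron P (mat_of_row y) *\<^sub>v vec_stack A) $ k
      = (\<Sum>p<m * n. (P $$ (k, p div n) * y $ (p mod n)) * A $$ (p mod n, p div n))"
    unfolding mult_mat_vec_nth[OF K vec_stack_carrier[OF A] k]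
    using P y A k n by (intro sum.cong refl) (simp add: kron_def vec_stack_def mult.commute)
  also have "\<dots> = (\<Sum>j<m. \<Sum>i<n. (P $$ (k, j) * y $ i) * A $$ (i, j))"
    by (rule sum_div_mod[OF n, where g = "\<lambda>j i. (P $$ (k, j) * y $ i) * A $$ (i, j)"])
  also have "\<dots> = (\<Sum>j<m. P $$ (k, j) * (transpose_mat A *\<^sub>v y) $ j)"
  proof (rule sum.cong[OF refl])
    fix j assume "j \<in> {..<m}"
    then have "(transpose_mat A *\<^sub>v y) $ j = (\<Sum>i<n. A $$ (i, j) * y $ i)"
      using mult_mat_vec_nth[of "transpose_mat A" m n y j] A y by simp
    then show "(\<Sum>i<n. (P $$ (k, j) * y $ i) * A $$ (i, j)) = P $$ (k, j) * (transpose_mat A *\<^sub>v y) $ j"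
      by (simp add: sum_distrib_left ac_simps)
  qed
  also have "\<dots> = (P *\<^sub>v (transpose_mat A *\<^sub>v y)) $ k"
    using mult_mat_vec_nth[of P a m "transpose_mat A *\<^sub>v y" k] P A y k by simp
  finally show "(kron P (mat_of_row y) *\<^sub>v vec_stack A) $ k = (P *\<^sub>v (transpose_mat A *\<^sub>v y)) $ k" .
qed (use P in \<open>simp add: kron_def\<close>)

lemma kron_row_left_mult_vec_stack:
  assumes P: "P \<in> carrier_mat a n" and r: "r \<in> carrier_vec m" and A: "A \<in> carrier_mat n m" and n: "0 < n"
  shows "kron (mat_of_row r) P *\<^sub>v vec_stack A = P *\<^sub>v (A *\<^sub>v r)"
proof (rule eq_vecI)
  fix k assume "k < dim_vec (P *\<^sub>v (A *\<^sub>v r))"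
  then have k: "k < a" using P by simp
  have K: "kron (mat_of_row r) P \<in> carrier_mat a (m * n)"
    using P r by (simp add: kron_def)
  have "(kron (mat_of_row r) P *\<^sub>v vec_stack A) $ k
      = (\<Sum>p<m * n. (r $ (p div n) * P $$ (k, p mod n)) * A $$ (p mod n, p div n))"
    unfolding mult_mat_vec_nth[OF K vec_stack_carrier[OF A] k]
    using P r A k n
    by (intro sum.cong refl) (simp add: kron_def vec_stack_def less_mult_imp_div_less mult.commute)
  also have "\<dots> = (\<Sum>j<m. \<Sum>i<n. (r $ j * P $$ (k, i)) * A $$ (i, j))"
    by (rule sum_div_mod[OF n, where g = "\<lambda>j i. (r $ j * P $$ (k, i)) * A $$ (i, j)"])
  also have "\<dots> = (\<Sum>i<n. \<Sum>j<m. (r $ j * P $$ (k, i)) * A $$ (i, j))"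
    by (rule sum.swap)
  also have "\<dots> = (\<Sum>i<n. P $$ (k, i) * (A *\<^sub>v r) $ i)"
  proof (rule sum.cong[OF refl])
    fix i assume "i \<in> {..<n}"
    then have "(A *\<^sub>v r) $ i = (\<Sum>j<m. A $$ (i, j) * r $ j)"
      using mult_mat_vec_nth[of A n m r i] A r by simp
    then show "(\<Sum>j<m. (r $ j * P $$ (k, i)) * A $$ (i, j)) = P $$ (k, i) * (A *\<^sub>v r) $ i"
      by (simp add: sum_distrib_left ac_simps)
  qed
  also have "\<dots> = (P *\<^sub>v (A *\<^sub>v r)) $ k"
    using mult_mat_vec_nth[of P a n "A *\<^sub>v r" k] P A r k by simp
  finally show "(kron (mat_of_row r) P *\<^sub>v vec_stack A) $ k = (P *\<^sub>v (A *\<^sub>v r)) $ k" .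
qed (use P in \<open>simp add: kron_def\<close>)

lemma toeplitz_space_carrier: "A \<in> toeplitz_space n m \<Longrightarrow> A \<in> carrier_mat n m"
  by (auto simp: toeplitz_space_def toeplitz_mat_def)

lemma vec_T_carrier: "A \<in> carrier_mat n m \<Longrightarrow> vec_T A \<in> carrier_vec (m + n - 1)"
  by (simp add: vec_T_def)

lemma vec_T_abs_mat:
  assumes A: "A \<in> carrier_mat n m" and "0 < n" "0 < m"
  shows "vec_T (abs_mat A) = abs_vec (vec_T A)"
  using assms by (intro eq_vecI) (auto simp: vec_T_def abs_mat_def abs_vec_def)

lemma toeplitz_space_transpose:
  assumes "A \<in> toeplitz_space m n"
  shows "transpose_mat A \<in> toeplitz_space n m"
proof -
  obtain t where "A = toeplitz_mat m n t" using assms by (auto simp: toeplitz_space_def)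
  then have "transpose_mat A = toeplitz_mat n m (\<lambda>l. t (- l))"
    by (auto simp: toeplitz_mat_def intro!: eq_matI)
  then show ?thesis by (simp add: toeplitz_space_def)
qed

lemma vec_T_toeplitz_mat_nth:
  assumes "0 < n" "0 < m" "k < m + n - 1"
  shows "vec_T (toeplitz_mat n m t) $ k = t (diag_no n k)"
proof -
  have "int (k - (n - 1)) - int (n - 1 - k) = diag_no n k"
    using assms by (auto simp: diag_no_def)
  then show ?thesis using assms by (simp add: vec_T_def toeplitz_mat_def)
qed

text \<open>With truncated subtraction read as exact, \<open>j + (n - 1) - i\<close> is the index at which the diagonal
  \<open>j - i\<close> is stored.\<close>

lemma toeplitz_nth:
  assumes "A \<in> toeplitz_space n m" "i < n" "j < m"
  shows "A $$ (i, j) = vec_T A $ (j + (n - 1) - i)"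
proof -
  obtain t where t: "A = toeplitz_mat n m t" using assms by (auto simp: toeplitz_space_def)
  have "diag_no n (j + (n - 1) - i) = int j - int i" using assms by (auto simp: diag_no_def)
  moreover have "vec_T A $ (j + (n - 1) - i) = t (diag_no n (j + (n - 1) - i))"
    unfolding t using assms by (intro vec_T_toeplitz_mat_nth) auto
  ultimately show ?thesis using assms by (simp add: t toeplitz_mat_def)
qed

lemma vec_T_surj:
  assumes "0 < n" "0 < m" "v \<in> carrier_vec (m + n - 1)"
  obtains T where "T \<in> toeplitz_space n m" "vec_T T = v"
proof
  let ?T = "toeplitz_mat n m (\<lambda>l. v $ nat (l + (int n - 1)))"
  show "?T \<in> toeplitz_space n m" by (simp add: toeplitz_space_def)
  show "vec_T ?T = v"
  proof (rule eq_vecI)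
    fix k assume "k < dim_vec v"
    then show "vec_T ?T $ k = v $ k"
      using assms by (simp add: vec_T_toeplitz_mat_nth diag_no_def)
  qed (use assms in \<open>simp add: vec_T_def toeplitz_mat_def\<close>)
qed

lemma Phi_T_carrier: "Phi_T n m \<in> carrier_mat (m * n) (m + n - 1)"
  by (rule carrier_matI) (simp_all add: Phi_T_def mult.commute)

lemma Phi_T_mult_vec_T:
  assumes A: "A \<in> toeplitz_space n m" and n: "0 < n" and m: "0 < m"
  shows "Phi_T n m *\<^sub>v vec_T A = vec_stack A"
proof (rule eq_vecI)
  note Ac = toeplitz_space_carrier[OF A]
  fix p assume "p < dim_vec (vec_stack A)"
  then have p: "p < m * n" using Ac by (simp add: vec_stack_def mult.commute)
  let ?i = "p mod n" and ?j = "p div n"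
  have ij: "?i < n" "?j < m" using p n by (auto simp: less_mult_imp_div_less)
  let ?k = "?j + (n - 1) - ?i"
  have k: "?k < m + n - 1" using ij n by linarith
  have "(Phi_T n m *\<^sub>v vec_T A) $ p = (\<Sum>k<m + n - 1. Phi_T n m $$ (p, k) * vec_T A $ k)"
    by (rule mult_mat_vec_nth[OF Phi_T_carrier vec_T_carrier[OF Ac] p])
  also have "\<dots> = (\<Sum>k<m + n - 1. if k = ?k then vec_T A $ k else 0)"
  proof (rule sum.cong[OF refl])
    fix k assume "k \<in> {..<m + n - 1}"
    then have "Phi_T n m $$ (p, k) = (if int ?j - int ?i = diag_no n k then 1 else 0)"
      using p ij
      by (simp add: Phi_T_def mat_of_cols_index vec_stack_def J_T_def toeplitz_mat_def mult.commute)
    moreover have "int ?j - int ?i = diag_no n k \<longleftrightarrow> k = ?k"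
      using ij unfolding diag_no_def by linarith
    ultimately show "Phi_T n m $$ (p, k) * vec_T A $ k = (if k = ?k then vec_T A $ k else 0)"
      by simp
  qed
  also have "\<dots> = vec_T A $ ?k" using k by (subst sum.delta) auto
  also have "\<dots> = A $$ (?i, ?j)" by (rule toeplitz_nth[OF A ij, symmetric])
  also have "\<dots> = vec_stack A $ p" using p Ac by (simp add: vec_stack_def mult.commute)
  finally show "(Phi_T n m *\<^sub>v vec_T A) $ p = vec_stack A $ p" .
next
  show "dim_vec (Phi_T n m *\<^sub>v vec_T A) = dim_vec (vec_stack A)"
    using toeplitz_space_carrier[OF A] Phi_T_carrier[of n m] by (simp add: vec_stack_def mult.commute)
qed

text \<open>The number of positions on the diagonal of an \<open>n \<times> m\<close> matrix that is stored at index \<open>k\<close>.\<close>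

definition diag_length :: "nat \<Rightarrow> nat \<Rightarrow> nat \<Rightarrow> nat" where
  "diag_length n m k = card {(i, j). i < n \<and> j < m \<and> int j - int i = diag_no n k}"

lemma D_T_eq: "D_T n m = mat_diag (m + n - 1) (\<lambda>k. sqrt (diag_length n m k))"
  by (simp add: D_T_def diag_length_def)

lemma diag_length_pos:
  assumes "k < m + n - 1" "0 < n" "0 < m"
  shows "0 < diag_length n m k"
proof -
  have "finite {(i, j). i < n \<and> j < m \<and> int j - int i = diag_no n k}"
    by (rule finite_subset[of _ "{..<n} \<times> {..<m}"]) auto
  moreover have "(n - 1 - k, k - (n - 1)) \<in> {(i, j). i < n \<and> j < m \<and> int j - int i = diag_no n k}"
    using assms by (auto simp: diag_no_def)
  ultimately show ?thesis unfolding diag_length_def card_gt_0_iff by blast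
qed

lemma sum_squares_toeplitz:
  assumes A: "A \<in> toeplitz_space n m"
  shows "(\<Sum>i<n. \<Sum>j<m. (A $$ (i, j))\<^sup>2) = (\<Sum>k<m + n - 1. diag_length n m k * (vec_T A $ k)\<^sup>2)"
proof -
  let ?P = "{..<n} \<times> {..<m}" and ?h = "\<lambda>(i, j). j + (n - 1) - i"
  have "(\<Sum>i<n. \<Sum>j<m. (A $$ (i, j))\<^sup>2) = (\<Sum>p\<in>?P. (A $$ p)\<^sup>2)"
    by (simp add: sum.cartesian_product)
  also have "\<dots> = (\<Sum>k<m + n - 1. \<Sum>p\<in>{p \<in> ?P. ?h p = k}. (A $$ p)\<^sup>2)"
    by (rule sum.group[symmetric]) auto
  also have "\<dots> = (\<Sum>k<m + n - 1. diag_length n m k * (vec_T A $ k)\<^sup>2)"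
  proof (rule sum.cong[OF refl])
    fix k assume "k \<in> {..<m + n - 1}"
    have "{p \<in> ?P. ?h p = k} = {(i, j). i < n \<and> j < m \<and> int j - int i = diag_no n k}"
      by (auto simp: diag_no_def)
    then have "diag_length n m k = card {p \<in> ?P. ?h p = k}" by (simp add: diag_length_def)
    moreover have "(\<Sum>p\<in>{p \<in> ?P. ?h p = k}. (A $$ p)\<^sup>2) = (\<Sum>p\<in>{p \<in> ?P. ?h p = k}. (vec_T A $ k)\<^sup>2)"
      by (rule sum.cong) (auto simp: toeplitz_nth[OF A])
    ultimately show "(\<Sum>p\<in>{p \<in> ?P. ?h p = k}. (A $$ p)\<^sup>2) = diag_length n m k * (vec_T A $ k)\<^sup>2"
      by simp
  qed
  finally show ?thesis .
qed

lemma D_T_carrier: "D_T n m \<in> carrier_mat (m + n - 1) (m + n - 1)"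
  by (simp add: D_T_eq)

lemma D_T_inverse:
  assumes "0 < n" "0 < m"
  shows "mat_inv (D_T n m) \<in> carrier_mat (m + n - 1) (m + n - 1)"
    "mat_inv (D_T n m) * D_T n m = 1\<^sub>m (m + n - 1)" "D_T n m * mat_inv (D_T n m) = 1\<^sub>m (m + n - 1)"
proof -
  let ?d = "\<lambda>k. sqrt (diag_length n m k)"
  have d: "?d k \<noteq> 0" if "k < m + n - 1" for k
    using diag_length_pos[OF that assms] by simp
  have inv: "mat_inv (D_T n m) = mat_diag (m + n - 1) (\<lambda>k. 1 / ?d k)"
    unfolding D_T_eq by (rule mat_inv_mat_diag) (rule d)
  have "1 / x * x = 1" "x * (1 / x) = 1" if "x \<noteq> 0" for x :: real
    using that by simp_all
  then have cancel: "1 / ?d k * ?d k = 1" "?d k * (1 / ?d k) = 1" if "k < m + n - 1" for k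
    using d[OF that] by blast+
  have "mat_diag (m + n - 1) (\<lambda>k. 1 / ?d k * ?d k) = mat_diag (m + n - 1) (\<lambda>_. 1)"
    "mat_diag (m + n - 1) (\<lambda>k. ?d k * (1 / ?d k)) = mat_diag (m + n - 1) (\<lambda>_. 1)"
    unfolding mat_diag_def by (rule cong_mat; simp only: cancel prod.case if_True split: if_split)+
  then show "mat_inv (D_T n m) \<in> carrier_mat (m + n - 1) (m + n - 1)"
    "mat_inv (D_T n m) * D_T n m = 1\<^sub>m (m + n - 1)" "D_T n m * mat_inv (D_T n m) = 1\<^sub>m (m + n - 1)"
    unfolding inv unfolding D_T_eq mat_diag_diag by (simp_all only: mat_diag_dim mat_diag_one)
qed

lemma hcat_vec_carrier: "A \<in> carrier_mat a b \<Longrightarrow> hcat_vec A v \<in> carrier_mat a (b + 1)"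
  by (rule carrier_matI) (simp_all add: hcat_vec_def)

lemma hcat_vec_nth:
  assumes "A \<in> carrier_mat a b" "i < a"
  shows "j < b \<Longrightarrow> hcat_vec A v $$ (i, j) = A $$ (i, j)" "hcat_vec A v $$ (i, b) = v $ i"
  using assms by (auto simp: hcat_vec_def mat_of_cols_index nth_append)

lemma norm_F_hcat_vec:
  assumes A: "A \<in> carrier_mat a b" and v: "v \<in> carrier_vec a"
  shows "norm_F (hcat_vec A v) = sqrt ((\<Sum>i<a. \<Sum>j<b. (A $$ (i, j))\<^sup>2) + v \<bullet> v)"
proof -
  have "(\<Sum>i<a. \<Sum>j<b + 1. (hcat_vec A v $$ (i, j))\<^sup>2) = (\<Sum>i<a. (\<Sum>j<b. (A $$ (i, j))\<^sup>2) + (v $ i)\<^sup>2)"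
    using A by (intro sum.cong refl) (simp add: hcat_vec_nth)
  also have "\<dots> = (\<Sum>i<a. \<Sum>j<b. (A $$ (i, j))\<^sup>2) + v \<bullet> v"
    using v by (simp add: sum.distrib scalar_prod_def atLeast0LessThan power2_eq_square)
  finally show ?thesis using hcat_vec_carrier[OF A, of v] by (simp add: norm_F_def)
qed

text \<open>The vector on the right lists the coordinates in which the Frobenius norm of \<open>[T\<^sup>T v]\<close>, with \<open>T\<close> Toeplitz, is a Euclidean
  norm.\<close>

lemma norm_F_hcat_vec_toeplitz:
  assumes T: "T \<in> toeplitz_space n m" and v: "v \<in> carrier_vec m"
  shows "norm_F (hcat_vec (transpose_mat T) v) = norm2_vec ((D_T n m *\<^sub>v vec_T T) @\<^sub>v v)"
proof -
  note Tc = toeplitz_space_carrier[OF T]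
  have D: "D_T n m *\<^sub>v vec_T T = vec (m + n - 1) (\<lambda>k. sqrt (diag_length n m k) * vec_T T $ k)"
  proof (rule eq_vecI)
    fix k assume "k < dim_vec (vec (m + n - 1) (\<lambda>k. sqrt (diag_length n m k) * vec_T T $ k))"
    then have k: "k < m + n - 1" by simp
    show "(D_T n m *\<^sub>v vec_T T) $ k = vec (m + n - 1) (\<lambda>k. sqrt (diag_length n m k) * vec_T T $ k) $ k"
      unfolding D_T_eq mat_diag_mult_vec_nth[OF vec_T_carrier[OF Tc] k] using k by simp
  qed (simp add: D_T_eq mat_diag_def)
  have "(\<Sum>i<m. \<Sum>j<n. (transpose_mat T $$ (i, j))\<^sup>2) = (\<Sum>i<m. \<Sum>j<n. (T $$ (j, i))\<^sup>2)"
    using Tc by (intro sum.cong refl) auto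
  also have "\<dots> = (\<Sum>i<n. \<Sum>j<m. (T $$ (i, j))\<^sup>2)"
    by (rule sum.swap)
  also have "\<dots> = (D_T n m *\<^sub>v vec_T T) \<bullet> (D_T n m *\<^sub>v vec_T T)"
    unfolding sum_squares_toeplitz[OF T] D
    by (auto simp: scalar_prod_def atLeast0LessThan power2_eq_square intro!: sum.cong)
  finally show ?thesis
    using norm_F_hcat_vec[of "transpose_mat T" m n v] Tc v
      scalar_prod_append[of "D_T n m *\<^sub>v vec_T T" "m + n - 1" v m "D_T n m *\<^sub>v vec_T T" v]
    by (simp add: norm2_vec_def D)
qed

lemma le_mat_abs_hcat_vec_iff:
  assumes A: "A \<in> carrier_mat a b" "A' \<in> carrier_mat a b" and v: "v \<in> carrier_vec a" "v' \<in> carrier_vec a"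
  shows "le_mat (abs_mat (hcat_vec A v)) (e \<cdot>\<^sub>m abs_mat (hcat_vec A' v')) \<longleftrightarrow>
    (\<forall>i<a. (\<forall>j<b. \<bar>A $$ (i, j)\<bar> \<le> e * \<bar>A' $$ (i, j)\<bar>) \<and> \<bar>v $ i\<bar> \<le> e * \<bar>v' $ i\<bar>)"
proof -
  let ?H = "hcat_vec A v" and ?H' = "hcat_vec A' v'"
  have c: "?H \<in> carrier_mat a (b + 1)" "?H' \<in> carrier_mat a (b + 1)"
    using hcat_vec_carrier A by blast+
  have "le_mat (abs_mat ?H) (e \<cdot>\<^sub>m abs_mat ?H') \<longleftrightarrow>
      (\<forall>i<a. \<forall>j<Suc b. \<bar>?H $$ (i, j)\<bar> \<le> e * \<bar>?H' $$ (i, j)\<bar>)"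
    using c by (simp add: le_mat_def abs_mat_def)
  also have "\<dots> \<longleftrightarrow> (\<forall>i<a. (\<forall>j<b. \<bar>?H $$ (i, j)\<bar> \<le> e * \<bar>?H' $$ (i, j)\<bar>)
      \<and> \<bar>?H $$ (i, b)\<bar> \<le> e * \<bar>?H' $$ (i, b)\<bar>)"
    unfolding All_less_Suc by blast
  also have "\<dots> \<longleftrightarrow> (\<forall>i<a. (\<forall>j<b. \<bar>A $$ (i, j)\<bar> \<le> e * \<bar>A' $$ (i, j)\<bar>)
      \<and> \<bar>v $ i\<bar> \<le> e * \<bar>v' $ i\<bar>)"
    using A by (simp add: hcat_vec_nth)
  finally show ?thesis .
qed

lemma hcat_mult_append:
  assumes A: "A \<in> carrier_mat a b" and B: "B \<in> carrier_mat a c"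
    and u: "u \<in> carrier_vec b" and v: "v \<in> carrier_vec c"
  shows "hcat A B *\<^sub>v (u @\<^sub>v v) = A *\<^sub>v u + B *\<^sub>v v"
proof (rule eq_vecI)
  fix i assume "i < dim_vec (A *\<^sub>v u + B *\<^sub>v v)"
  then have i: "i < a" using B by simp
  have "row (hcat A B) i = row A i @\<^sub>v row B i"
    using A B i by (intro eq_vecI) (auto simp: hcat_def mat_of_cols_index nth_append)
  then show "(hcat A B *\<^sub>v (u @\<^sub>v v)) $ i = (A *\<^sub>v u + B *\<^sub>v v) $ i"
    using A B u v i scalar_prod_append[of "row A i" b "row B i" c u v]
    by (simp add: hcat_def)
qed (use A B in \<open>simp add: hcat_def\<close>)

lemma hcat_carrier: "A \<in> carrier_mat a b \<Longrightarrow> B \<in> carrier_mat a c \<Longrightarrow> hcat A B \<in> carrier_mat a (b + c)"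
  by (rule carrier_matI) (simp_all add: hcat_def)

section \<open>Normal equations and the exact perturbation equations\<close>

lemma sym_mat_scalar_prod:
  assumes W: "(W :: real mat) \<in> carrier_mat m m" "transpose_mat W = W"
    and uv: "u \<in> carrier_vec m" "v \<in> carrier_vec m"
  shows "u \<bullet> (W *\<^sub>v v) = v \<bullet> (W *\<^sub>v u)"
proof -
  have "u \<bullet> (W *\<^sub>v v) = (W *\<^sub>v u) \<bullet> v"
    using transpose_vec_mult_scalar[OF W(1) uv(2,1)] W(2) by simp
  also have "\<dots> = v \<bullet> (W *\<^sub>v u)"
    using W uv by (intro comm_scalar_prod[of _ m]) auto
  finally show ?thesis .
qed

lemma sym_mat_quadratic_expand:
  assumes W: "(W :: real mat) \<in> carrier_mat m m" "transpose_mat W = W"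
    and u: "u \<in> carrier_vec m" and v: "v \<in> carrier_vec m"
  shows "(u + t \<cdot>\<^sub>v v) \<bullet> (W *\<^sub>v (u + t \<cdot>\<^sub>v v))
    = u \<bullet> (W *\<^sub>v u) + 2 * t * (v \<bullet> (W *\<^sub>v u)) + t\<^sup>2 * (v \<bullet> (W *\<^sub>v v))"
proof -
  have Wc: "W *\<^sub>v u \<in> carrier_vec m" "W *\<^sub>v v \<in> carrier_vec m" "t \<cdot>\<^sub>v (W *\<^sub>v v) \<in> carrier_vec m" 
    "t \<cdot>\<^sub>v v \<in> carrier_vec m"
    using W u v by auto
  have "W *\<^sub>v (u + t \<cdot>\<^sub>v v) = W *\<^sub>v u + t \<cdot>\<^sub>v (W *\<^sub>v v)"
    using mult_add_distrib_mat_vec[OF W(1) u Wc(4)] mult_mat_vec[OF W(1) v] by simp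
  then have "(u + t \<cdot>\<^sub>v v) \<bullet> (W *\<^sub>v (u + t \<cdot>\<^sub>v v))
    = u \<bullet> (W *\<^sub>v u) + t * (u \<bullet> (W *\<^sub>v v)) + (t * (v \<bullet> (W *\<^sub>v u)) + t * (t * (v \<bullet> (W *\<^sub>v v))))"
    using u v Wc
    by (simp add: add_scalar_prod_distrib[of _ m] scalar_prod_add_distrib[of _ m]
        smult_scalar_prod_distrib[of _ m] scalar_prod_smult_distrib[of _ m] distrib_left)
  then show ?thesis
    using sym_mat_scalar_prod[OF W u v] by (simp add: power2_eq_square)
qed

lemma rls_objective_eq:
  assumes Q: "Q \<in> carrier_mat m n" and W: "W \<in> carrier_mat m m"
    and Wh: "is_spd_sqrt Wh W" and lam: "0 < lam"
    and f: "f \<in> carrier_vec m" and z: "z \<in> carrier_vec n"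
  shows "rls_objective Wh lam Q f z
    = (Q *\<^sub>v z - f) \<bullet> (W *\<^sub>v (Q *\<^sub>v z - f)) + lam * (z \<bullet> z)"
proof -
  have WhW: "Wh * Wh = W" "square_mat Wh" "transpose_mat Wh = Wh"
    using Wh by (auto simp: is_spd_sqrt_def sym_pos_def_def)
  have "dim_row Wh = dim_row (Wh * Wh)" by simp
  then have Whc: "Wh \<in> carrier_mat m m"
    using WhW(1,2) W by (intro carrier_matI) auto
  let ?e = "Q *\<^sub>v z - f"
  have e: "?e \<in> carrier_vec m" using Q z f by auto
  have I: "sqrt lam \<cdot>\<^sub>m 1\<^sub>m n \<in> carrier_mat n n" by simp
  have "(sqrt lam \<cdot>\<^sub>m 1\<^sub>m n) *\<^sub>v z = sqrt lam \<cdot>\<^sub>v z"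
    using z by (intro eq_vecI) auto
  then have "((Wh * Q) @\<^sub>r (sqrt lam \<cdot>\<^sub>m 1\<^sub>m n)) *\<^sub>v z = (Wh *\<^sub>v (Q *\<^sub>v z)) @\<^sub>v (sqrt lam \<cdot>\<^sub>v z)"
    using mat_mult_append[OF mult_carrier_mat[OF Whc Q] I z] assoc_mult_mat_vec[OF Whc Q z] by simp
  moreover have "((Wh *\<^sub>v (Q *\<^sub>v z)) @\<^sub>v (sqrt lam \<cdot>\<^sub>v z)) - ((Wh *\<^sub>v f) @\<^sub>v 0\<^sub>v n)
      = (Wh *\<^sub>v ?e) @\<^sub>v (sqrt lam \<cdot>\<^sub>v z)"
  proof -
    have "Wh *\<^sub>v ?e = Wh *\<^sub>v (Q *\<^sub>v z) - Wh *\<^sub>v f"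
      using Whc Q z f by (intro mult_minus_distrib_mat_vec) auto
    then show ?thesis
      using Whc z by (intro eq_vecI) auto
  qed
  ultimately have "rls_objective Wh lam Q f z
      = (norm2_vec ((Wh *\<^sub>v ?e) @\<^sub>v (sqrt lam \<cdot>\<^sub>v z)))\<^sup>2"
    using Q by (simp add: rls_objective_def)
  also have "\<dots> = (Wh *\<^sub>v ?e) \<bullet> (Wh *\<^sub>v ?e) + (sqrt lam \<cdot>\<^sub>v z) \<bullet> (sqrt lam \<cdot>\<^sub>v z)"
    unfolding norm2_vec_def real_sqrt_pow2[OF scalar_prod_self_nonneg]
    using scalar_prod_append[of "Wh *\<^sub>v ?e" m "sqrt lam \<cdot>\<^sub>v z" n "Wh *\<^sub>v ?e" "sqrt lam \<cdot>\<^sub>v z"]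
      Whc e z by simp
  also have "(Wh *\<^sub>v ?e) \<bullet> (Wh *\<^sub>v ?e) = ?e \<bullet> (W *\<^sub>v ?e)"
    using transpose_vec_mult_scalar[of Wh m m "Wh *\<^sub>v ?e" ?e] Whc e WhW
      assoc_mult_mat_vec[OF Whc Whc e] by simp
  also have "(sqrt lam \<cdot>\<^sub>v z) \<bullet> (sqrt lam \<cdot>\<^sub>v z) = (sqrt lam * sqrt lam) * (z \<bullet> z)"
    using z by (simp add: smult_scalar_prod_distrib[of _ n] scalar_prod_smult_distrib[of _ n])
  finally show ?thesis using lam by simp
qed

text \<open>Half of the gradient of the objective at \<open>y\<close> is \<open>g = Q\<^sup>T W (Q y - f) + \<lambda> y\<close>. Along the line
  \<open>y + t g\<close> the objective grows by \<open>2 t s + t\<^sup>2 c\<close> with \<open>s = g \<bullet> g\<close> and some \<open>c \<ge> 0\<close>, which is nonnegative for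
  all \<open>t\<close> only if \<open>s = 0\<close>.\<close>

lemma rls_minimizer_normal_equation:
  assumes Q: "Q \<in> carrier_mat m n" and W: "W \<in> carrier_mat m m" "sym_pos_def W"
    and Wh: "is_spd_sqrt Wh W" and lam: "0 < lam" and f: "f \<in> carrier_vec m"
    and min: "is_arg_min (rls_objective Wh lam Q f) (\<lambda>z. z \<in> carrier_vec n) y"
  shows "transpose_mat Q *\<^sub>v (W *\<^sub>v (f - Q *\<^sub>v y)) = lam \<cdot>\<^sub>v y"
proof -
  have y: "y \<in> carrier_vec n" and
    min': "\<And>z. z \<in> carrier_vec n \<Longrightarrow> rls_objective Wh lam Q f y \<le> rls_objective Wh lam Q f z"
    using min by (auto simp: is_arg_min_def not_less)
  have WT: "transpose_mat W = W" using W(2) by (simp add: sym_pos_def_def)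
  note obj = rls_objective_eq[OF Q W(1) Wh lam f]
  define e where "e = Q *\<^sub>v y - f"
  have e: "e \<in> carrier_vec m" using Q y f by (auto simp: e_def)
  have We: "W *\<^sub>v e \<in> carrier_vec m" using W e by auto
  have QT: "transpose_mat Q \<in> carrier_mat n m" using Q by simp
  have QWe: "transpose_mat Q *\<^sub>v (W *\<^sub>v e) \<in> carrier_vec n" using QT We by simp
  define g where "g = transpose_mat Q *\<^sub>v (W *\<^sub>v e) + lam \<cdot>\<^sub>v y"
  have g: "g \<in> carrier_vec n" using QWe y by (auto simp: g_def)
  have Qg: "Q *\<^sub>v g \<in> carrier_vec m" using Q g by auto
  define s where "s = g \<bullet> g"
  define c where "c = (Q *\<^sub>v g) \<bullet> (W *\<^sub>v (Q *\<^sub>v g)) + lam * s"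
  have s: "0 \<le> s" by (simp add: s_def scalar_prod_self_nonneg)
  have c: "0 \<le> c" using sym_pos_def_nonneg[OF W(2,1) Qg] s lam by (simp add: c_def)
  have grad: "(Q *\<^sub>v g) \<bullet> (W *\<^sub>v e) + lam * (g \<bullet> y) = s"
  proof -
    have "(Q *\<^sub>v g) \<bullet> (W *\<^sub>v e) = (W *\<^sub>v e) \<bullet> (Q *\<^sub>v g)"
      using comm_scalar_prod[OF Qg We] .
    also have "\<dots> = (transpose_mat Q *\<^sub>v (W *\<^sub>v e)) \<bullet> g"
      using transpose_vec_mult_scalar[OF Q g We] by simp
    also have "\<dots> = g \<bullet> (transpose_mat Q *\<^sub>v (W *\<^sub>v e))"
      using comm_scalar_prod[OF QWe g] .
    finally have "(Q *\<^sub>v g) \<bullet> (W *\<^sub>v e) + lam * (g \<bullet> y) = g \<bullet> (transpose_mat Q *\<^sub>v (W *\<^sub>v e)) + g \<bullet> (lam \<cdot>\<^sub>v y)"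
      using scalar_prod_smult_distrib[OF g y] by simp
    also have "\<dots> = g \<bullet> g"
      using scalar_prod_add_distrib[OF g QWe, of "lam \<cdot>\<^sub>v y"] y by (simp flip: g_def)
    finally show ?thesis by (simp add: s_def)
  qed
  have key: "0 \<le> 2 * t * s + t\<^sup>2 * c" for t
  proof -
    have z: "y + t \<cdot>\<^sub>v g \<in> carrier_vec n" using y g by auto
    have "Q *\<^sub>v (y + t \<cdot>\<^sub>v g) = Q *\<^sub>v y + t \<cdot>\<^sub>v (Q *\<^sub>v g)"
      using mult_add_distrib_mat_vec[OF Q y, of "t \<cdot>\<^sub>v g"] mult_mat_vec[OF Q g] g by simp
    then have "Q *\<^sub>v (y + t \<cdot>\<^sub>v g) - f = e + t \<cdot>\<^sub>v (Q *\<^sub>v g)"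
      using Q y g f by (intro eq_vecI) (auto simp: e_def)
    then have "rls_objective Wh lam Q f (y + t \<cdot>\<^sub>v g)
        = (e + t \<cdot>\<^sub>v (Q *\<^sub>v g)) \<bullet> (W *\<^sub>v (e + t \<cdot>\<^sub>v (Q *\<^sub>v g)))
          + lam * ((y + t \<cdot>\<^sub>v g) \<bullet> (y + t \<cdot>\<^sub>v g))"
      using obj[OF z] by simp
    also have "(y + t \<cdot>\<^sub>v g) \<bullet> (y + t \<cdot>\<^sub>v g) = y \<bullet> y + 2 * t * (g \<bullet> y) + t\<^sup>2 * s"
      using sym_mat_quadratic_expand[of "1\<^sub>m n" n y g t] y g z by (simp add: s_def)
    also have "(e + t \<cdot>\<^sub>v (Q *\<^sub>v g)) \<bullet> (W *\<^sub>v (e + t \<cdot>\<^sub>v (Q *\<^sub>v g)))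
        = e \<bullet> (W *\<^sub>v e) + 2 * t * ((Q *\<^sub>v g) \<bullet> (W *\<^sub>v e)) + t\<^sup>2 * ((Q *\<^sub>v g) \<bullet> (W *\<^sub>v (Q *\<^sub>v g)))"
      by (rule sym_mat_quadratic_expand[OF W(1) WT e Qg])
    finally have "rls_objective Wh lam Q f (y + t \<cdot>\<^sub>v g)
        = rls_objective Wh lam Q f y + 2 * t * ((Q *\<^sub>v g) \<bullet> (W *\<^sub>v e) + lam * (g \<bullet> y)) + t\<^sup>2 * c"
      using obj[OF y] by (simp add: c_def e_def algebra_simps)
    then show ?thesis using min'[OF z] unfolding grad by simp
  qed
  have "s = 0"
  proof (rule ccontr)
    assume "s \<noteq> 0"
    with s have s': "0 < s" by simp
    \<comment> \<open>The step below is negative and small enough for the linear term to dominate.\<close>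
    have "2 * (- (s / (c + 1))) * s + (- (s / (c + 1)))\<^sup>2 * c = - (s\<^sup>2 * (c + 2) / (c + 1)\<^sup>2)"
      using c by (simp add: divide_simps power2_eq_square) (simp add: algebra_simps)
    moreover have "0 < s\<^sup>2 * (c + 2) / (c + 1)\<^sup>2" using s' c by simp
    ultimately show False using key[of "- (s / (c + 1))"] by linarith
  qed
  then have g0: "g = 0\<^sub>v n" using scalar_prod_self_eq_0[OF g] by (simp add: s_def)
  have "f - Q *\<^sub>v y = - e" using Q y f by (intro eq_vecI) (auto simp: e_def)
  then have "W *\<^sub>v (f - Q *\<^sub>v y) = - (W *\<^sub>v e)"
    using W e by (intro eq_vecI) (auto simp: scalar_prod_uminus_right)
  then have *: "transpose_mat Q *\<^sub>v (W *\<^sub>v (f - Q *\<^sub>v y)) = - (transpose_mat Q *\<^sub>v (W *\<^sub>v e))"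
    using W e Q by (intro eq_vecI) (auto simp: scalar_prod_uminus_right)
  show ?thesis
  proof (rule eq_vecI)
    fix i assume "i < dim_vec (lam \<cdot>\<^sub>v y)"
    then have i: "i < n" using y by simp
    have "g $ i = 0" using g0 i by simp
    then have "(transpose_mat Q *\<^sub>v (W *\<^sub>v e)) $ i + (lam \<cdot>\<^sub>v y) $ i = 0"
      unfolding g_def using i y QWe by (subst (asm) index_add_vec) auto
    then show "(transpose_mat Q *\<^sub>v (W *\<^sub>v (f - Q *\<^sub>v y))) $ i = (lam \<cdot>\<^sub>v y) $ i"
      unfolding * using i Q by (subst index_uminus_vec) (auto simp del: index_mult_mat_vec)
  qed (use Q y in auto)
qed

text \<open>The data of the problem, with the minimizer \<open>y\<close> described by its normal equation
  \<open>Q\<^sup>T r = \<lambda> y\<close>.\<close>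

locale rls_solution =
  fixes m n :: nat and Q W :: "real mat" and f y r :: "real vec" and lam :: real
  assumes n_pos: "0 < n" and m_pos: "0 < m"
    and Q: "Q \<in> carrier_mat m n" and Q_toeplitz: "transpose_mat Q \<in> toeplitz_space n m"
    and W: "W \<in> carrier_mat m m" and W_spd: "sym_pos_def W" and lam_pos: "0 < lam"
    and f: "f \<in> carrier_vec m" and y: "y \<in> carrier_vec n"
    and r_eq: "r = W *\<^sub>v (f - Q *\<^sub>v y)"
    and normal_eq: "transpose_mat Q *\<^sub>v r = lam \<cdot>\<^sub>v y"
begin

lemma r: "r \<in> carrier_vec m"
  using Q W f y by (auto simp: r_eq)

text \<open>The matrix of the normal equations of the problem with coefficient matrix \<open>X\<close>.\<close>

definition gram :: "real mat \<Rightarrow> real mat" where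
  "gram X = lam \<cdot>\<^sub>m 1\<^sub>m n + transpose_mat X * W * X"

lemma gram_carrier: "X \<in> carrier_mat m n \<Longrightarrow> gram X \<in> carrier_mat n n"
  by (auto simp: gram_def)

lemma gram_mult:
  assumes X: "X \<in> carrier_mat m n" and x: "x \<in> carrier_vec n"
  shows "gram X *\<^sub>v x = lam \<cdot>\<^sub>v x + transpose_mat X *\<^sub>v (W *\<^sub>v (X *\<^sub>v x))"
proof -
  have XT: "transpose_mat X \<in> carrier_mat n m" using X by simp
  have "gram X *\<^sub>v x = (lam \<cdot>\<^sub>m 1\<^sub>m n) *\<^sub>v x + (transpose_mat X * W * X) *\<^sub>v x"
    unfolding gram_def using X x W by (intro add_mult_distrib_mat_vec[of _ n n]) auto
  also have "(lam \<cdot>\<^sub>m 1\<^sub>m n) *\<^sub>v x = lam \<cdot>\<^sub>v x"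
    using x by (intro eq_vecI) auto
  also have "(transpose_mat X * W * X) *\<^sub>v x = transpose_mat X *\<^sub>v (W *\<^sub>v (X *\<^sub>v x))"
    using assoc_mult_mat_vec[of "transpose_mat X * W" n m X n x]
      assoc_mult_mat_vec[OF XT W, of "X *\<^sub>v x"] X XT W x by simp
  finally show ?thesis .
qed

lemma gram_trivial_kernel:
  assumes X: "X \<in> carrier_mat m n" and x: "x \<in> carrier_vec n" and 0: "gram X *\<^sub>v x = 0\<^sub>v n"
  shows "x = 0\<^sub>v n"
proof -
  have Xx: "X *\<^sub>v x \<in> carrier_vec m" using X x by auto
  have WXx: "W *\<^sub>v (X *\<^sub>v x) \<in> carrier_vec m" using W Xx by auto
  have XT: "transpose_mat X *\<^sub>v (W *\<^sub>v (X *\<^sub>v x)) \<in> carrier_vec n" using X WXx by auto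
  have "0 = x \<bullet> (gram X *\<^sub>v x)" using 0 x by simp
  also have "\<dots> = lam * (x \<bullet> x) + x \<bullet> (transpose_mat X *\<^sub>v (W *\<^sub>v (X *\<^sub>v x)))"
    unfolding gram_mult[OF X x] using x XT
    by (simp add: scalar_prod_add_distrib[of _ n] scalar_prod_smult_distrib[of _ n])
  also have "x \<bullet> (transpose_mat X *\<^sub>v (W *\<^sub>v (X *\<^sub>v x))) = (X *\<^sub>v x) \<bullet> (W *\<^sub>v (X *\<^sub>v x))"
    using transpose_vec_mult_scalar[OF X x WXx] comm_scalar_prod[OF x XT] comm_scalar_prod[OF Xx WXx]
    by simp
  finally have "lam * (x \<bullet> x) + (X *\<^sub>v x) \<bullet> (W *\<^sub>v (X *\<^sub>v x)) = 0" by simp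
  moreover have "0 \<le> (X *\<^sub>v x) \<bullet> (W *\<^sub>v (X *\<^sub>v x))" by (rule sym_pos_def_nonneg[OF W_spd W Xx])
  moreover have "0 \<le> lam * (x \<bullet> x)" using lam_pos scalar_prod_self_nonneg[of x] by simp
  ultimately have "lam * (x \<bullet> x) = 0" by linarith
  then show ?thesis using lam_pos scalar_prod_self_eq_0[OF x] by simp
qed

text \<open>No smallness of the perturbation is needed.\<close>

lemma perturbed_solution_exists:
  assumes X: "X \<in> carrier_mat m n" and F: "F \<in> carrier_vec m"
  obtains z where "z \<in> carrier_vec n"
    "transpose_mat X *\<^sub>v (W *\<^sub>v (F - X *\<^sub>v z)) = lam \<cdot>\<^sub>v z"
proof -
  note inv = mat_inv_of_trivial_kernel[OF gram_carrier[OF X] gram_trivial_kernel[OF X]]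
  define g where "g = transpose_mat X *\<^sub>v (W *\<^sub>v F)"
  define z where "z = mat_inv (gram X) *\<^sub>v g"
  have XT: "transpose_mat X \<in> carrier_mat n m" using X by simp
  have g: "g \<in> carrier_vec n" using X W F by (auto simp: g_def)
  have z: "z \<in> carrier_vec n" using inv(1) g by (simp add: z_def)
  have "gram X *\<^sub>v z = (gram X * mat_inv (gram X)) *\<^sub>v g"
    unfolding z_def by (rule assoc_mult_mat_vec[OF gram_carrier[OF X] inv(1) g, symmetric])
  then have gz: "g = gram X *\<^sub>v z" using inv(2) g by simp
  have Xz: "X *\<^sub>v z \<in> carrier_vec m" "W *\<^sub>v F \<in> carrier_vec m" "W *\<^sub>v (X *\<^sub>v z) \<in> carrier_vec m"
    using X z W F by auto
  have XWXz: "transpose_mat X *\<^sub>v (W *\<^sub>v (X *\<^sub>v z)) \<in> carrier_vec n" using XT Xz by simp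
  have lz: "lam \<cdot>\<^sub>v z \<in> carrier_vec n" using z by simp
  have "transpose_mat X *\<^sub>v (W *\<^sub>v (F - X *\<^sub>v z)) = g - transpose_mat X *\<^sub>v (W *\<^sub>v (X *\<^sub>v z))"
    unfolding mult_minus_distrib_mat_vec[OF W F Xz(1)] g_def
    by (rule mult_minus_distrib_mat_vec[OF XT Xz(2,3)])
  also have "\<dots> = lam \<cdot>\<^sub>v z"
    unfolding gz gram_mult[OF X z] by (rule vec_add_diff_cancel[OF lz XWXz])
  finally show ?thesis using that z by blast
qed

lemma augmented_system_iff:
  assumes X: "X \<in> carrier_mat m n" and F: "F \<in> carrier_vec m"
    and s: "s \<in> carrier_vec m" and z: "z \<in> carrier_vec n"
  shows "augmented_mat W lam X *\<^sub>v (s @\<^sub>v z) = F @\<^sub>v 0\<^sub>v n \<longleftrightarrow>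
    s = W *\<^sub>v (F - X *\<^sub>v z) \<and> transpose_mat X *\<^sub>v s = lam \<cdot>\<^sub>v z"
proof -
  note inv = sym_pos_def_inverse[OF W W_spd]
  let ?V = "mat_inv W"
  have Xz: "X *\<^sub>v z \<in> carrier_vec m" and Vs: "?V *\<^sub>v s \<in> carrier_vec m"
    and Xs: "transpose_mat X *\<^sub>v s \<in> carrier_vec n" using X z s inv by auto
  have FX: "F - X *\<^sub>v z \<in> carrier_vec m" using F Xz by simp
  have "((- lam) \<cdot>\<^sub>m 1\<^sub>m n) *\<^sub>v z = - (lam \<cdot>\<^sub>v z)"
    using z by (intro eq_vecI) auto
  then have "augmented_mat W lam X *\<^sub>v (s @\<^sub>v z)
      = (?V *\<^sub>v s + X *\<^sub>v z) @\<^sub>v (transpose_mat X *\<^sub>v s + - (lam \<cdot>\<^sub>v z))"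
    using four_block_mat_mult_vec[of ?V m m X n "transpose_mat X" n "(- lam) \<cdot>\<^sub>m 1\<^sub>m n" s z] inv X s z
    by (simp add: augmented_mat_def)
  also have "\<dots> = F @\<^sub>v 0\<^sub>v n \<longleftrightarrow>
      ?V *\<^sub>v s + X *\<^sub>v z = F \<and> transpose_mat X *\<^sub>v s + - (lam \<cdot>\<^sub>v z) = 0\<^sub>v n"
    using Vs Xz F by (intro append_vec_eq[of _ m]) auto
  also have "transpose_mat X *\<^sub>v s + - (lam \<cdot>\<^sub>v z) = 0\<^sub>v n \<longleftrightarrow> transpose_mat X *\<^sub>v s = lam \<cdot>\<^sub>v z"
    using Xs z by (intro vec_add_uminus_eq_0_iff) auto
  also have "?V *\<^sub>v s + X *\<^sub>v z = F \<longleftrightarrow> ?V *\<^sub>v s = F - X *\<^sub>v z"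
    by (rule vec_add_eq_iff_diff[OF Vs Xz F])
  also have "\<dots> \<longleftrightarrow> s = W *\<^sub>v (F - X *\<^sub>v z)"
  proof
    assume "?V *\<^sub>v s = F - X *\<^sub>v z"
    then have "W *\<^sub>v (F - X *\<^sub>v z) = (W * ?V) *\<^sub>v s"
      using assoc_mult_mat_vec[OF W inv(1) s] by simp
    then show "s = W *\<^sub>v (F - X *\<^sub>v z)" using inv(2) s by simp
  next
    assume "s = W *\<^sub>v (F - X *\<^sub>v z)"
    then have "?V *\<^sub>v s = (?V * W) *\<^sub>v (F - X *\<^sub>v z)"
      using assoc_mult_mat_vec[OF inv(1) W FX] by simp
    then show "?V *\<^sub>v s = F - X *\<^sub>v z" using inv(3) FX by simp
  qed
  finally show ?thesis .
qed

lemma rls_perturbation_iff: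
  "rls_perturbation W lam Q f r y dQ df dr dy \<longleftrightarrow>
    dQ \<in> carrier_mat m n \<and> transpose_mat dQ \<in> toeplitz_space n m \<and>
    df \<in> carrier_vec m \<and> dr \<in> carrier_vec m \<and> dy \<in> carrier_vec n \<and>
    r + dr = W *\<^sub>v ((f + df) - (Q + dQ) *\<^sub>v (y + dy)) \<and>
    transpose_mat (Q + dQ) *\<^sub>v (r + dr) = lam \<cdot>\<^sub>v (y + dy)"
proof -
  have "augmented_mat W lam (Q + dQ) *\<^sub>v ((r + dr) @\<^sub>v (y + dy)) = (f + df) @\<^sub>v 0\<^sub>v n \<longleftrightarrow>
      r + dr = W *\<^sub>v ((f + df) - (Q + dQ) *\<^sub>v (y + dy)) \<and>
      transpose_mat (Q + dQ) *\<^sub>v (r + dr) = lam \<cdot>\<^sub>v (y + dy)"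
    if "dQ \<in> carrier_mat m n" "df \<in> carrier_vec m" "dr \<in> carrier_vec m" "dy \<in> carrier_vec n"
    using that Q f r y by (intro augmented_system_iff) auto
  then show ?thesis using Q by (auto simp: rls_perturbation_def)
qed

lemma rls_perturbation_exists:
  assumes dQ: "dQ \<in> carrier_mat m n" "transpose_mat dQ \<in> toeplitz_space n m" and df: "df \<in> carrier_vec m"
  obtains dr dy where "rls_perturbation W lam Q f r y dQ df dr dy"
proof -
  have QdQ: "Q + dQ \<in> carrier_mat m n" and F: "f + df \<in> carrier_vec m" using Q dQ f df by auto
  obtain z where z: "z \<in> carrier_vec n"
    "transpose_mat (Q + dQ) *\<^sub>v (W *\<^sub>v ((f + df) - (Q + dQ) *\<^sub>v z)) = lam \<cdot>\<^sub>v z"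
    using perturbed_solution_exists[OF QdQ F] by blast
  define s where "s = W *\<^sub>v ((f + df) - (Q + dQ) *\<^sub>v z)"
  have s: "s \<in> carrier_vec m" using QdQ F z W by (auto simp: s_def)
  have "r + (s - r) = s" "y + (z - y) = z" using r s y z by auto
  then have "rls_perturbation W lam Q f r y dQ df (s - r) (z - y)"
    using dQ df s r y z unfolding rls_perturbation_iff by (simp add: s_def)
  then show ?thesis using that by blast
qed

text \<open>The inverse of the Schur complement \<open>S = - (\<lambda> I + Q\<^sup>T W Q)\<close> of \<open>W\<^sup>-\<^sup>1\<close> in the augmented matrix, and
  the matrix that maps \<open>f\<close> to the solution \<open>y\<close>.\<close>

definition Sinv :: "real mat" where
  "Sinv = mat_inv (- gram Q)"

definition K :: "real mat" where
  "K = - (Sinv * transpose_mat Q * W)"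

lemma Sinv: "Sinv \<in> carrier_mat n n" "Sinv * - gram Q = 1\<^sub>m n"
proof -
  have c: "- gram Q \<in> carrier_mat n n" using gram_carrier[OF Q] by simp
  have "x = 0\<^sub>v n" if "x \<in> carrier_vec n" "- gram Q *\<^sub>v x = 0\<^sub>v n" for x
  proof -
    have gx: "gram Q *\<^sub>v x \<in> carrier_vec n" using gram_carrier[OF Q] that by simp
    have "- (gram Q *\<^sub>v x) = 0\<^sub>v n"
      using that gram_carrier[OF Q] by simp
    then have "gram Q *\<^sub>v x = 0\<^sub>v n"
      using gx by (metis uminus_uminus_vec uminus_zero_vec)
    then show ?thesis using gram_trivial_kernel[OF Q] that by blast
  qed
  from mat_inv_of_trivial_kernel[OF c this]
  show "Sinv \<in> carrier_mat n n" "Sinv * - gram Q = 1\<^sub>m n" by (auto simp: Sinv_def)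
qed

lemma K_carrier: "K \<in> carrier_mat n m"
  using Sinv Q W by (auto simp: K_def)

lemma K_mult:
  assumes x: "x \<in> carrier_vec m"
  shows "K *\<^sub>v x = - (Sinv *\<^sub>v (transpose_mat Q *\<^sub>v (W *\<^sub>v x)))"
proof -
  have QT: "transpose_mat Q \<in> carrier_mat n m" using Q by simp
  have "(Sinv * transpose_mat Q * W) *\<^sub>v x = Sinv *\<^sub>v (transpose_mat Q *\<^sub>v (W *\<^sub>v x))"
    using assoc_mult_mat_vec[OF mult_carrier_mat[OF Sinv(1) QT] W x]
      assoc_mult_mat_vec[OF Sinv(1) QT mult_mat_vec_carrier[OF W x]] by simp
  then show ?thesis unfolding K_def using x W by simp
qed

text \<open>The exact, still implicit, equations for the change of the solution; the first-order part of
  \<open>dy\<close> results from deleting \<open>dy\<close> and \<open>dr\<close> on the right.\<close>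

lemma perturbation_equations:
  assumes "rls_perturbation W lam Q f r y dQ df dr dy"
  shows "dr = W *\<^sub>v (df - dQ *\<^sub>v (y + dy) - Q *\<^sub>v dy)"
    and "dy = K *\<^sub>v (df - dQ *\<^sub>v (y + dy)) - Sinv *\<^sub>v (transpose_mat dQ *\<^sub>v (r + dr))"
proof -
  from assms have dQ: "dQ \<in> carrier_mat m n" and df: "df \<in> carrier_vec m" and dr: "dr \<in> carrier_vec m"
    and dy: "dy \<in> carrier_vec n"
    and r': "r + dr = W *\<^sub>v ((f + df) - (Q + dQ) *\<^sub>v (y + dy))"
    and n': "transpose_mat (Q + dQ) *\<^sub>v (r + dr) = lam \<cdot>\<^sub>v (y + dy)"
    by (auto simp: rls_perturbation_iff)
  define z where "z = df - dQ *\<^sub>v (y + dy)"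
  define w where "w = transpose_mat dQ *\<^sub>v (r + dr)"
  have ydy: "y + dy \<in> carrier_vec n" and rdr: "r + dr \<in> carrier_vec m" using y dy r dr by auto
  have dQy: "dQ *\<^sub>v (y + dy) \<in> carrier_vec m" using dQ ydy by simp
  have z: "z \<in> carrier_vec m" using df dQy by (simp add: z_def)
  have w: "w \<in> carrier_vec n" using dQ rdr by (simp add: w_def)
  have Qy: "Q *\<^sub>v y \<in> carrier_vec m" "Q *\<^sub>v dy \<in> carrier_vec m" using Q y dy by auto
  have fQ: "f - Q *\<^sub>v y \<in> carrier_vec m" and zQ: "z - Q *\<^sub>v dy \<in> carrier_vec m"
    using f Qy z by auto
  have "(Q + dQ) *\<^sub>v (y + dy) = Q *\<^sub>v y + Q *\<^sub>v dy + dQ *\<^sub>v (y + dy)"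
    using add_mult_distrib_mat_vec[OF Q dQ ydy] mult_add_distrib_mat_vec[OF Q y dy] by simp
  moreover have "(f + df) - (a + b + c) = (f - a) + ((df - c) - b)"
    if "a \<in> carrier_vec m" "b \<in> carrier_vec m" "c \<in> carrier_vec m" for a b c
    using that f df by (auto simp: vec_eq_iff)
  ultimately have "(f + df) - (Q + dQ) *\<^sub>v (y + dy) = (f - Q *\<^sub>v y) + (z - Q *\<^sub>v dy)"
    using Qy dQy by (simp add: z_def)
  then have "r + dr = r + W *\<^sub>v (z - Q *\<^sub>v dy)"
    using r' mult_add_distrib_mat_vec[OF W fQ zQ] by (simp add: r_eq)
  moreover have Wz: "W *\<^sub>v (z - Q *\<^sub>v dy) \<in> carrier_vec m" using W zQ by simp
  ultimately show dr_eq: "dr = W *\<^sub>v (df - dQ *\<^sub>v (y + dy) - Q *\<^sub>v dy)"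
    using vec_add_left_cancel[OF r dr] unfolding z_def by blast
  have QT: "transpose_mat Q \<in> carrier_mat n m" "transpose_mat dQ \<in> carrier_mat n m" using Q dQ by auto
  have QTdr: "transpose_mat Q *\<^sub>v dr \<in> carrier_vec n" using QT dr by simp
  have "transpose_mat (Q + dQ) *\<^sub>v (r + dr) = transpose_mat Q *\<^sub>v r + transpose_mat Q *\<^sub>v dr + w"
    using add_mult_distrib_mat_vec[OF QT rdr] mult_add_distrib_mat_vec[OF QT(1) r dr] transpose_add[OF Q dQ]
    by (simp add: w_def)
  then have e1: "lam \<cdot>\<^sub>v y + transpose_mat Q *\<^sub>v dr + w = lam \<cdot>\<^sub>v (y + dy)"
    using n' normal_eq by simp
  have QWz: "transpose_mat Q *\<^sub>v (W *\<^sub>v z) \<in> carrier_vec n" 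
    and QWQ: "transpose_mat Q *\<^sub>v (W *\<^sub>v (Q *\<^sub>v dy)) \<in> carrier_vec n"
    using QT W z Qy by auto
  have e2: "transpose_mat Q *\<^sub>v dr = transpose_mat Q *\<^sub>v (W *\<^sub>v z) - transpose_mat Q *\<^sub>v (W *\<^sub>v (Q *\<^sub>v dy))"
    unfolding dr_eq z_def[symmetric] mult_minus_distrib_mat_vec[OF W z Qy(2)]
    using QT W z Qy by (intro mult_minus_distrib_mat_vec) auto
  have "gram Q *\<^sub>v dy = transpose_mat Q *\<^sub>v (W *\<^sub>v z) + w"
  proof -
    have "lam \<cdot>\<^sub>v dy + b = a + w" if "lam \<cdot>\<^sub>v y + (a - b) + w = lam \<cdot>\<^sub>v (y + dy)"
      "a \<in> carrier_vec n" "b \<in> carrier_vec n" for a b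
      using that w y dy by (auto simp: vec_eq_iff algebra_simps)
    from this[OF e1[unfolded e2] QWz QWQ] show ?thesis unfolding gram_mult[OF Q dy] .
  qed
  moreover have gc: "- gram Q \<in> carrier_mat n n" using gram_carrier[OF Q] by simp
  moreover have "- gram Q *\<^sub>v dy = - (gram Q *\<^sub>v dy)" using gram_carrier[OF Q] dy by simp
  ultimately have "- gram Q *\<^sub>v dy = - (transpose_mat Q *\<^sub>v (W *\<^sub>v z)) - w"
    using vec_uminus_add[OF QWz w] by simp
  moreover have "dy = (Sinv * - gram Q) *\<^sub>v dy" using Sinv(2) dy by simp
  ultimately have dy_eq: "dy = Sinv *\<^sub>v (- (transpose_mat Q *\<^sub>v (W *\<^sub>v z)) - w)"
    using assoc_mult_mat_vec[OF Sinv(1) gc dy] by simp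
  also have "Sinv *\<^sub>v (- (transpose_mat Q *\<^sub>v (W *\<^sub>v z)) - w) = Sinv *\<^sub>v (- (transpose_mat Q *\<^sub>v (W *\<^sub>v z))) - Sinv *\<^sub>v w"
    using Sinv w QWz by (intro mult_minus_distrib_mat_vec) auto
  also have "Sinv *\<^sub>v (- (transpose_mat Q *\<^sub>v (W *\<^sub>v z))) = K *\<^sub>v z"
    unfolding K_mult[OF z] by (rule mult_mat_vec_uminus[OF Sinv(1) QWz])
  finally show "dy = K *\<^sub>v (df - dQ *\<^sub>v (y + dy)) - Sinv *\<^sub>v (transpose_mat dQ *\<^sub>v (r + dr))"
    by (simp add: z_def w_def)
qed

end

section \<open>First-order expansion of the solution\<close>

text \<open>A quantity bounded by a small multiple of one plus itself is itself small.\<close>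

lemma small_gain:
  assumes "x \<le> e * c * (1 + x)" "0 \<le> x" "0 \<le> e" "0 \<le> c" "2 * (e * (c + 1)) \<le> (1::real)"
  shows "x \<le> 2 * e * c"
proof -
  have ec: "0 \<le> e * c" using assms by simp
  have "2 * (e * c) \<le> 1" using assms by (simp add: algebra_simps)
  then have "2 * (e * c) * x \<le> 1 * x" using assms by (intro mult_right_mono) auto
  moreover have "x \<le> e * c + e * c * x" using assms(1) by (simp add: algebra_simps)
  ultimately show ?thesis by linarith
qed

context rls_solution
begin

text \<open>The negative derivative of the solution \<open>y\<close> with respect to the diagonals of \<open>Q\<^sup>T\<close>.\<close>

definition B :: "real mat" where
  "B = (kron K (mat_of_row y) + kron (mat_of_row r) Sinv) * Phi_T n m"

lemma kron_carriers:
  "kron K (mat_of_row y) \<in> carrier_mat n (m * n)" "kron (mat_of_row r) Sinv \<in> carrier_mat n (m * n)"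
  using K_carrier Sinv y r by (auto simp: kron_def)

lemma B_carrier: "B \<in> carrier_mat n (m + n - 1)"
  unfolding B_def by (rule mult_carrier_mat[OF add_carrier_mat[OF kron_carriers(2)] Phi_T_carrier])

lemma B_mult_vec_T:
  assumes T: "T \<in> toeplitz_space n m"
  shows "B *\<^sub>v vec_T T = K *\<^sub>v (transpose_mat T *\<^sub>v y) + Sinv *\<^sub>v (T *\<^sub>v r)"
proof -
  note Tc = toeplitz_space_carrier[OF T]
  have "B *\<^sub>v vec_T T = (kron K (mat_of_row y) + kron (mat_of_row r) Sinv) *\<^sub>v vec_stack T"
    unfolding B_def Phi_T_mult_vec_T[OF T n_pos m_pos, symmetric]
    by (rule assoc_mult_mat_vec[OF _ Phi_T_carrier vec_T_carrier[OF Tc]])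
      (rule add_carrier_mat[OF kron_carriers(2)])
  also have "\<dots> = kron K (mat_of_row y) *\<^sub>v vec_stack T + kron (mat_of_row r) Sinv *\<^sub>v vec_stack T"
    by (rule add_mult_distrib_mat_vec[OF kron_carriers vec_stack_carrier[OF Tc]])
  finally show ?thesis
    using kron_row_right_mult_vec_stack[OF K_carrier y Tc n_pos]
      kron_row_left_mult_vec_stack[OF Sinv(1) r Tc n_pos] by simp
qed

text \<open>The derivative of the map from the data to the solution \<open>y\<close>, applied to the perturbation \<open>df\<close> of
  \<open>f\<close> and to the Toeplitz perturbation of \<open>Q\<^sup>T\<close> with diagonals \<open>t\<close>.\<close>

definition first_order :: "real vec \<Rightarrow> real vec \<Rightarrow> real vec" where
  "first_order t df = K *\<^sub>v df - B *\<^sub>v t"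

lemma first_order_carrier: "first_order t df \<in> carrier_vec n"
  by (rule carrier_vecI) (simp add: first_order_def carrier_matD[OF B_carrier])

lemma first_order_error:
  assumes pert: "rls_perturbation W lam Q f r y dQ df dr dy"
  shows "dy - first_order (vec_T (transpose_mat dQ)) df
    = - (K *\<^sub>v (dQ *\<^sub>v dy)) - Sinv *\<^sub>v (transpose_mat dQ *\<^sub>v dr)"
proof -
  from pert have dQ: "dQ \<in> carrier_mat m n" "transpose_mat dQ \<in> toeplitz_space n m"
    and df: "df \<in> carrier_vec m" and dr: "dr \<in> carrier_vec m" and dy: "dy \<in> carrier_vec n"
    by (auto simp: rls_perturbation_iff)
  have dQT: "transpose_mat dQ \<in> carrier_mat n m" using dQ by simp
  have dQv: "dQ *\<^sub>v y \<in> carrier_vec m" "dQ *\<^sub>v dy \<in> carrier_vec m"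
    "transpose_mat dQ *\<^sub>v r \<in> carrier_vec n" "transpose_mat dQ *\<^sub>v dr \<in> carrier_vec n"
    using dQ y dy r dr by auto
  have Kv: "K *\<^sub>v df \<in> carrier_vec n" "K *\<^sub>v (dQ *\<^sub>v y) \<in> carrier_vec n" "K *\<^sub>v (dQ *\<^sub>v dy) \<in> carrier_vec n"
    and Sv: "Sinv *\<^sub>v (transpose_mat dQ *\<^sub>v r) \<in> carrier_vec n"
    "Sinv *\<^sub>v (transpose_mat dQ *\<^sub>v dr) \<in> carrier_vec n"
    using K_carrier Sinv(1) df dQv by auto
  have "K *\<^sub>v (df - dQ *\<^sub>v (y + dy)) = K *\<^sub>v df - (K *\<^sub>v (dQ *\<^sub>v y) + K *\<^sub>v (dQ *\<^sub>v dy))"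
    using mult_minus_distrib_mat_vec[OF K_carrier df, of "dQ *\<^sub>v y + dQ *\<^sub>v dy"] dQv
      mult_add_distrib_mat_vec[OF K_carrier dQv(1,2)] mult_add_distrib_mat_vec[OF dQ(1) y dy] by simp
  moreover have "Sinv *\<^sub>v (transpose_mat dQ *\<^sub>v (r + dr))
      = Sinv *\<^sub>v (transpose_mat dQ *\<^sub>v r) + Sinv *\<^sub>v (transpose_mat dQ *\<^sub>v dr)"
    using mult_add_distrib_mat_vec[OF Sinv(1) dQv(3,4)] mult_add_distrib_mat_vec[OF dQT r dr] by simp
  ultimately have 1: "dy = (K *\<^sub>v df - (K *\<^sub>v (dQ *\<^sub>v y) + K *\<^sub>v (dQ *\<^sub>v dy)))
      - (Sinv *\<^sub>v (transpose_mat dQ *\<^sub>v r) + Sinv *\<^sub>v (transpose_mat dQ *\<^sub>v dr))"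
    using perturbation_equations(2)[OF pert] by simp
  have 2: "first_order (vec_T (transpose_mat dQ)) df
      = K *\<^sub>v df - (K *\<^sub>v (dQ *\<^sub>v y) + Sinv *\<^sub>v (transpose_mat dQ *\<^sub>v r))"
    unfolding first_order_def B_mult_vec_T[OF dQ(2)] by simp
  have "((a - (b + c)) - (d + e)) - (a - (b + d)) = - c - e"
    if "a \<in> carrier_vec n" "b \<in> carrier_vec n" "c \<in> carrier_vec n" "d \<in> carrier_vec n" "e \<in> carrier_vec n"
    for a b c d e :: "real vec"
    using that by (auto simp: vec_eq_iff)
  from this[OF Kv Sv] show ?thesis unfolding 2 by (subst 1)
qed

text \<open>The remainder of the first-order expansion is quadratic in the size of the perturbation.\<close>

lemma first_order_remainder:
  obtains C e0 where "0 \<le> C" "0 < e0"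
    "\<And>dQ df dr dy e. rls_perturbation W lam Q f r y dQ df dr dy \<Longrightarrow> 0 \<le> e \<Longrightarrow> e \<le> e0 \<Longrightarrow>
      norm1_mat dQ \<le> e \<Longrightarrow> norm1_vec df \<le> e \<Longrightarrow>
      norm1_vec (dy - first_order (vec_T (transpose_mat dQ)) df) \<le> C * e\<^sup>2"
proof -
  define k s w where "k = norm1_mat K" and "s = norm1_mat Sinv" and "w = norm1_mat W"
  define ny nr nQ where "ny = norm1_vec y" and "nr = norm1_vec r" and "nQ = norm1_mat Q"
  have nonneg: "0 \<le> k" "0 \<le> s" "0 \<le> w" "0 \<le> ny" "0 \<le> nr" "0 \<le> nQ"
    by (simp_all add: k_def s_def w_def ny_def nr_def nQ_def)
  define c1 where "c1 = k * (1 + ny) + s * (1 + nr)"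
  define c2 where "c2 = w * ((1 + ny) + nQ * c1)"
  define c3 where "c3 = c1 + c2"
  have c: "0 \<le> c1" "0 \<le> c2" "0 \<le> c3" using nonneg by (simp_all add: c1_def c2_def c3_def)
  show ?thesis
  proof (rule that[of "2 * (k + s) * c3" "1 / (2 * (c3 + 1))"])
    fix dQ df dr dy and e :: real
    assume pert: "rls_perturbation W lam Q f r y dQ df dr dy" and e: "0 \<le> e" "e \<le> 1 / (2 * (c3 + 1))"
      and dQe: "norm1_mat dQ \<le> e" and dfe: "norm1_vec df \<le> e"
    from pert have dQ: "dQ \<in> carrier_mat m n" "transpose_mat dQ \<in> toeplitz_space n m"
      and df: "df \<in> carrier_vec m" and dr: "dr \<in> carrier_vec m" and dy: "dy \<in> carrier_vec n"
      by (auto simp: rls_perturbation_iff)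
    have dQT: "transpose_mat dQ \<in> carrier_mat n m" using dQ by simp
    define a b where "a = norm1_vec dy" and "b = norm1_vec dr"
    have ab: "0 \<le> a" "0 \<le> b" by (simp_all add: a_def b_def)
    have ydy: "y + dy \<in> carrier_vec n" "r + dr \<in> carrier_vec m" using y dy r dr by auto
    have dQy: "dQ *\<^sub>v (y + dy) \<in> carrier_vec m" "transpose_mat dQ *\<^sub>v (r + dr) \<in> carrier_vec n"
      using dQ ydy by auto
    have dfQ: "df - dQ *\<^sub>v (y + dy) \<in> carrier_vec m" using df dQy by simp
    have Qdy: "Q *\<^sub>v dy \<in> carrier_vec m" using Q dy by simp
    \<comment> \<open>Every product of the perturbation with a vector is small.\<close>
    have dQ_mult: "norm1_vec (dQ *\<^sub>v x) \<le> e * norm1_vec x" if "x \<in> carrier_vec n" for x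
      using norm1_mult_mat_vec_le[OF dQ(1) that] mult_right_mono[OF dQe, of "norm1_vec x"] by simp
    have dQT_mult: "norm1_vec (transpose_mat dQ *\<^sub>v x) \<le> e * norm1_vec x" if "x \<in> carrier_vec m" for x
      using norm1_mult_mat_vec_le[OF dQT that] mult_right_mono[OF dQe, of "norm1_vec x"]
      by (simp add: norm1_mat_transpose)
    have z: "norm1_vec (df - dQ *\<^sub>v (y + dy)) \<le> e * ((1 + ny) * (1 + (a + b)))"
    proof -
      have "norm1_vec (df - dQ *\<^sub>v (y + dy)) \<le> e + e * norm1_vec (y + dy)"
        using norm1_vec_diff_le[OF df dQy(1)] dQ_mult[OF ydy(1)] dfe by linarith
      also have "\<dots> \<le> e + e * (ny + a)"
        using norm1_vec_add_le[OF y dy] e(1) by (auto simp: ny_def a_def intro: mult_left_mono)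
      also have "\<dots> = e * (1 + ny + a)" by (simp add: algebra_simps)
      also have "\<dots> \<le> e * ((1 + ny) * (1 + (a + b)))"
        using e(1) nonneg ab by (intro mult_left_mono) (auto simp: algebra_simps)
      finally show ?thesis .
    qed
    have x: "norm1_vec (transpose_mat dQ *\<^sub>v (r + dr)) \<le> e * ((1 + nr) * (1 + (a + b)))"
    proof -
      have "norm1_vec (transpose_mat dQ *\<^sub>v (r + dr)) \<le> e * (nr + b)"
        using dQT_mult[OF ydy(2)] mult_left_mono[OF norm1_vec_add_le[OF r dr] e(1)]
        by (simp add: nr_def b_def)
      also have "\<dots> \<le> e * ((1 + nr) * (1 + (a + b)))"
        using e(1) nonneg ab by (intro mult_left_mono) (auto simp: algebra_simps)
      finally show ?thesis .
    qed
    have a_le: "a \<le> e * c1 * (1 + (a + b))"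
    proof -
      have "a \<le> norm1_vec (K *\<^sub>v (df - dQ *\<^sub>v (y + dy))) + norm1_vec (Sinv *\<^sub>v (transpose_mat dQ *\<^sub>v (r + dr)))"
        unfolding a_def using K_carrier Sinv(1) dfQ dQy
        by (subst perturbation_equations(2)[OF pert]) (intro norm1_vec_diff_le[of _ n], auto)
      also have "\<dots> \<le> k * (e * ((1 + ny) * (1 + (a + b)))) + s * (e * ((1 + nr) * (1 + (a + b))))"
        using norm1_mult_mat_vec_le[OF K_carrier dfQ] mult_left_mono[OF z nonneg(1)]
          norm1_mult_mat_vec_le[OF Sinv(1) dQy(2)] mult_left_mono[OF x nonneg(2)]
        unfolding k_def[symmetric] s_def[symmetric] by linarith
      also have "\<dots> = e * c1 * (1 + (a + b))" by (simp add: c1_def algebra_simps)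
      finally show ?thesis .
    qed
    have b_le: "b \<le> e * c2 * (1 + (a + b))"
    proof -
      have "b \<le> w * norm1_vec (df - dQ *\<^sub>v (y + dy) - Q *\<^sub>v dy)"
        unfolding b_def w_def using dfQ Qdy
        by (subst perturbation_equations(1)[OF pert]) (intro norm1_mult_mat_vec_le[OF W], auto)
      also have "\<dots> \<le> w * (e * ((1 + ny) * (1 + (a + b))) + nQ * (e * c1 * (1 + (a + b))))"
        using norm1_vec_diff_le[OF dfQ Qdy] z norm1_mult_mat_vec_le[OF Q dy]
          mult_left_mono[OF a_le nonneg(6)] nonneg(3)
        unfolding nQ_def[symmetric] a_def[symmetric] by (intro mult_left_mono) linarith+
      also have "\<dots> = e * c2 * (1 + (a + b))" by (simp add: c2_def algebra_simps)
      finally show ?thesis .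
    qed
    have sum_le: "a + b \<le> 2 * e * c3"
    proof (rule small_gain)
      show "a + b \<le> e * c3 * (1 + (a + b))"
        using a_le b_le by (simp add: c3_def algebra_simps)
      show "2 * (e * (c3 + 1)) \<le> 1"
        using e(2) c(3) by (simp add: field_simps)
    qed (use ab e c in auto)
    have Kv: "K *\<^sub>v (dQ *\<^sub>v dy) \<in> carrier_vec n" "Sinv *\<^sub>v (transpose_mat dQ *\<^sub>v dr) \<in> carrier_vec n"
      and dQv: "dQ *\<^sub>v dy \<in> carrier_vec m" "transpose_mat dQ *\<^sub>v dr \<in> carrier_vec n"
      using K_carrier Sinv(1) dQ dy dr by auto
    have "norm1_vec (dy - first_order (vec_T (transpose_mat dQ)) df)
        \<le> norm1_vec (K *\<^sub>v (dQ *\<^sub>v dy)) + norm1_vec (Sinv *\<^sub>v (transpose_mat dQ *\<^sub>v dr))"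
      unfolding first_order_error[OF pert]
      using norm1_vec_diff_le[of "- (K *\<^sub>v (dQ *\<^sub>v dy))" n, OF _ Kv(2)] Kv(1) by simp
    also have "\<dots> \<le> k * (e * a) + s * (e * b)"
      using norm1_mult_mat_vec_le[OF K_carrier dQv(1)] mult_left_mono[OF dQ_mult[OF dy] nonneg(1)]
        norm1_mult_mat_vec_le[OF Sinv(1) dQv(2)] mult_left_mono[OF dQT_mult[OF dr] nonneg(2)]
      unfolding k_def[symmetric] s_def[symmetric] a_def[symmetric] b_def[symmetric] by linarith
    also have "\<dots> \<le> (k + s) * e * (a + b)"
      using nonneg ab e by (simp add: algebra_simps)
    also have "\<dots> \<le> (k + s) * e * (2 * e * c3)"
      using sum_le nonneg e by (intro mult_left_mono) auto
    also have "\<dots> = 2 * (k + s) * c3 * e\<^sup>2" by (simp add: power2_eq_square)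
    finally show "norm1_vec (dy - first_order (vec_T (transpose_mat dQ)) df) \<le> 2 * (k + s) * c3 * e\<^sup>2" .
  qed (use nonneg c in auto)
qed

end

section \<open>Structured condition numbers\<close>

lemma tendsto_Sup_ereal:
  fixes F :: "'a \<Rightarrow> ereal set"
  assumes upper: "\<And>e. 0 < e \<Longrightarrow> \<forall>\<^sub>F h in G. \<forall>x\<in>F h. x \<le> ereal (v + e)"
    and lower: "\<And>e. 0 < e \<Longrightarrow> \<forall>\<^sub>F h in G. \<exists>x\<in>F h. ereal (v - e) \<le> x"
  shows "((\<lambda>h. Sup (F h)) \<longlongrightarrow> ereal v) G"
proof (rule order_tendstoI)
  fix a assume "a < ereal v"
  then obtain u where u: "a < ereal u" "u < v" by (metis ereal_dense2 ereal_less(1) less_ereal.simps(1))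
  show "\<forall>\<^sub>F h in G. a < Sup (F h)"
    using lower[of "v - u"] u by (auto elim!: eventually_mono intro: less_le_trans order_trans Sup_upper)
next
  fix a assume "ereal v < a"
  then obtain u where u: "ereal u < a" "v < u" by (metis ereal_dense2 less_ereal.simps(1))
  have "Sup (F h) \<le> ereal (v + (u - v))" if "\<forall>x\<in>F h. x \<le> ereal (v + (u - v))" for h
    using that by (intro Sup_least) auto
  then show "\<forall>\<^sub>F h in G. Sup (F h) < a"
    using upper[of "u - v"] u by (auto elim!: eventually_mono intro: le_less_trans)
qed

context rls_solution
begin

text \<open>The common scheme of the three condition numbers. The function \<open>N\<close> measures the change of the
  solution and \<open>P h\<close> restricts the perturbations to size \<open>h\<close>. The last two assumptions say that \<open>h v\<close> is
  the supremum of \<open>N\<close> over the images of these perturbations under the derivative.\<close>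

lemma condition_number_limit:
  assumes N: "\<And>u v. u \<in> carrier_vec n \<Longrightarrow> v \<in> carrier_vec n \<Longrightarrow> N u \<le> N v + c * norm1_vec (u - v)"
    and c: "0 \<le> c" and d: "0 < d"
    and small: "\<And>h dQ df. 0 < h \<Longrightarrow> dQ \<in> carrier_mat m n \<Longrightarrow> df \<in> carrier_vec m \<Longrightarrow> P h dQ df \<Longrightarrow>
      norm1_mat dQ \<le> d * h \<and> norm1_vec df \<le> d * h"
    and upper: "\<And>h T df. 0 < h \<Longrightarrow> T \<in> toeplitz_space n m \<Longrightarrow> df \<in> carrier_vec m \<Longrightarrow>
      P h (transpose_mat T) df \<Longrightarrow> N (first_order (vec_T T) df) \<le> h * v"
    and lower: "\<And>h e. 0 < h \<Longrightarrow> 0 < e \<Longrightarrow> \<exists>T df. T \<in> toeplitz_space n m \<and> df \<in> carrier_vec m \<and>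
      P h (transpose_mat T) df \<and> h * (v - e) \<le> N (first_order (vec_T T) df)"
  shows "((\<lambda>h. Sup {ereal (N dy / h) | dQ df dr dy.
      rls_perturbation W lam Q f r y dQ df dr dy \<and> P h dQ df}) \<longlongrightarrow> ereal v) (at_right 0)"
proof -
  obtain C e0 where C: "0 \<le> C" and e0: "0 < e0"
    and rem: "\<And>dQ df dr dy e. rls_perturbation W lam Q f r y dQ df dr dy \<Longrightarrow> 0 \<le> e \<Longrightarrow> e \<le> e0 \<Longrightarrow>
      norm1_mat dQ \<le> e \<Longrightarrow> norm1_vec df \<le> e \<Longrightarrow>
      norm1_vec (dy - first_order (vec_T (transpose_mat dQ)) df) \<le> C * e\<^sup>2"
    using first_order_remainder by blast
  define D where "D = c * C * d\<^sup>2"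
  have D: "0 \<le> D" using c C by (simp add: D_def)
  have ev: "\<forall>\<^sub>F h in at_right 0. 0 < h \<and> d * h \<le> e0 \<and> D * h \<le> e" if "0 < e" for e
  proof -
    have "0 < min (e0 / d) (e / (D + 1))" using that e0 d D by simp
    then show ?thesis unfolding eventually_at_right_field
    proof (intro exI conjI allI impI)
      fix h assume h: "0 < h" "h < min (e0 / d) (e / (D + 1))"
      then show "d * h \<le> e0" using d by (simp add: field_simps)
      have "(D + 1) * h \<le> e" using h D by (simp add: field_simps)
      then show "D * h \<le> e" using h by (simp add: algebra_simps)
    qed
  qed
  have close: "\<bar>N dy - N (first_order (vec_T (transpose_mat dQ)) df)\<bar> \<le> h * e"
    if pert: "rls_perturbation W lam Q f r y dQ df dr dy" and P: "P h dQ df"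
      and h: "0 < h" "d * h \<le> e0" "D * h \<le> e" for dQ df dr dy h e
  proof -
    let ?l = "first_order (vec_T (transpose_mat dQ)) df"
    from pert have cs: "dQ \<in> carrier_mat m n" "df \<in> carrier_vec m" and dy: "dy \<in> carrier_vec n"
      by (auto simp: rls_perturbation_iff)
    have "norm1_vec (dy - ?l) \<le> C * (d * h)\<^sup>2"
      using small[OF h(1) cs P] h d by (intro rem[OF pert]) auto
    then have "c * norm1_vec (dy - ?l) \<le> c * (C * (d * h)\<^sup>2)" using c by (rule mult_left_mono)
    also have "\<dots> = h * (D * h)" by (simp add: D_def power2_eq_square)
    also have "\<dots> \<le> h * e" using h by (intro mult_left_mono) auto
    finally show ?thesis
      using N[OF dy first_order_carrier, of "vec_T (transpose_mat dQ)" df]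
        N[OF first_order_carrier dy, of "vec_T (transpose_mat dQ)" df]
        norm1_vec_diff_commute[OF dy first_order_carrier, of "vec_T (transpose_mat dQ)" df]
      by (simp add: abs_le_iff)
  qed
  show ?thesis
  proof (rule tendsto_Sup_ereal)
    fix e :: real assume e: "0 < e"
    show "\<forall>\<^sub>F h in at_right 0. \<forall>x\<in>{ereal (N dy / h) | dQ df dr dy.
        rls_perturbation W lam Q f r y dQ df dr dy \<and> P h dQ df}. x \<le> ereal (v + e)"
      using ev[OF e]
    proof (rule eventually_mono, safe)
      fix h dQ df dr dy
      assume h: "0 < h" "d * h \<le> e0" "D * h \<le> e"
        and pert: "rls_perturbation W lam Q f r y dQ df dr dy" and P: "P h dQ df"
      have "N (first_order (vec_T (transpose_mat dQ)) df) \<le> h * v"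
        using pert P h(1) by (intro upper) (auto simp: rls_perturbation_iff)
      then have "N dy \<le> h * (v + e)"
        using close[OF pert P h] by (simp add: algebra_simps)
      then show "ereal (N dy / h) \<le> ereal (v + e)" using h(1) by (simp add: field_simps)
    qed
  next
    fix e :: real assume e: "0 < e"
    then have e2: "0 < e / 2" by simp
    show "\<forall>\<^sub>F h in at_right 0. \<exists>x\<in>{ereal (N dy / h) | dQ df dr dy.
        rls_perturbation W lam Q f r y dQ df dr dy \<and> P h dQ df}. ereal (v - e) \<le> x"
      using ev[OF e2]
    proof (rule eventually_mono)
      fix h assume h': "0 < h \<and> d * h \<le> e0 \<and> D * h \<le> e / 2"
      then have h: "0 < h" "d * h \<le> e0" "D * h \<le> e / 2" by auto
      obtain T df where T: "T \<in> toeplitz_space n m" "df \<in> carrier_vec m" "P h (transpose_mat T) df"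
        "h * (v - e / 2) \<le> N (first_order (vec_T T) df)"
        using lower[OF h(1) e2] by blast
      obtain dr dy where pert: "rls_perturbation W lam Q f r y (transpose_mat T) df dr dy"
        using rls_perturbation_exists[of "transpose_mat T" df] T toeplitz_space_carrier[OF T(1)] by auto
      have "\<bar>N dy - N (first_order (vec_T T) df)\<bar> \<le> h * (e / 2)"
        using close[OF pert T(3) h] by simp
      moreover have "h * (v - e) = h * (v - e / 2) - h * (e / 2)" by (simp add: algebra_simps)
      ultimately have "h * (v - e) \<le> N dy" using T(4) by linarith
      then have "ereal (v - e) \<le> ereal (N dy / h)"
        using h(1) by (simp add: pos_le_divide_eq mult.commute)
      then show "\<exists>x\<in>{ereal (N dy / h) | dQ df dr dy.
        rls_perturbation W lam Q f r y dQ df dr dy \<and> P h dQ df}. ereal (v - e) \<le> x"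
        using pert T(3) by blast
    qed
  qed
qed

lemma normwise_limit:
  assumes y0: "y \<noteq> 0\<^sub>v n"
  shows "(normwise_sup W lam Q f r y \<longlongrightarrow>
    ereal (norm2_mat (hcat (B * mat_inv (D_T n m)) (- K)) * norm_F (hcat_vec Q f) / norm2_vec y)) (at_right 0)"
proof -
  let ?l = "m + n - 1"
  define V where "V = mat_inv (D_T n m)"
  define H where "H = hcat (B * V) (- K)"
  define NF where "NF = norm_F (hcat_vec Q f)"
  define ny where "ny = norm2_vec y"
  have ny: "0 < ny" unfolding ny_def by (rule norm2_vec_pos[OF y y0])
  have NF: "0 \<le> NF" by (simp add: NF_def norm_F_nonneg)
  have V: "V \<in> carrier_mat ?l ?l" "V * D_T n m = 1\<^sub>m ?l" "D_T n m * V = 1\<^sub>m ?l"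
    using D_T_inverse[OF n_pos m_pos] by (auto simp: V_def)
  note D = D_T_carrier[of n m]
  have BV: "B * V \<in> carrier_mat n ?l" using B_carrier V by simp
  have mK: "- K \<in> carrier_mat n m" using K_carrier by simp
  have H: "H \<in> carrier_mat n (?l + m)" unfolding H_def by (rule hcat_carrier[OF BV mK])
  have H_mult: "H *\<^sub>v ((D_T n m *\<^sub>v t) @\<^sub>v df) = - first_order t df"
    if t: "t \<in> carrier_vec ?l" and df: "df \<in> carrier_vec m" for t df
  proof -
    have Dt: "D_T n m *\<^sub>v t \<in> carrier_vec ?l" using D t by simp
    have "V *\<^sub>v (D_T n m *\<^sub>v t) = t"
      using assoc_mult_mat_vec[OF V(1) D t] V(2) t by simp
    then have "(B * V) *\<^sub>v (D_T n m *\<^sub>v t) = B *\<^sub>v t"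
      using assoc_mult_mat_vec[OF B_carrier V(1) Dt] by simp
    moreover have "- K *\<^sub>v df = - (K *\<^sub>v df)" using K_carrier df by simp
    ultimately have "H *\<^sub>v ((D_T n m *\<^sub>v t) @\<^sub>v df) = B *\<^sub>v t + - (K *\<^sub>v df)"
      unfolding H_def using hcat_mult_append[OF BV mK Dt df] by simp
    moreover have "b + - a = - (a - b)" if "a \<in> carrier_vec n" "b \<in> carrier_vec n" for a b :: "real vec"
      using that by (auto simp: vec_eq_iff)
    moreover have "B *\<^sub>v t \<in> carrier_vec n" "K *\<^sub>v df \<in> carrier_vec n"
      using B_carrier K_carrier t df by auto
    ultimately show ?thesis by (simp add: first_order_def)
  qed
  have "((\<lambda>h. Sup {ereal (norm2_vec dy / ny / h) | dQ df dr dy.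
      rls_perturbation W lam Q f r y dQ df dr dy \<and> norm_F (hcat_vec dQ df) \<le> h * NF}) \<longlongrightarrow>
      ereal (norm2_mat H * NF / ny)) (at_right 0)"
  proof (rule condition_number_limit[where c = "1 / ny" and d = "real (m * n + m) * NF + 1"])
    fix u v :: "real vec" assume u: "u \<in> carrier_vec n" and v: "v \<in> carrier_vec n"
    have "v + (u - v) = u" using u v by auto
    then have "norm2_vec u \<le> norm2_vec v + norm1_vec (u - v)"
      using norm2_vec_add_le[of v n "u - v"] norm2_vec_le_norm1_vec[of "u - v"] u v by simp
    then show "norm2_vec u / ny \<le> norm2_vec v / ny + 1 / ny * norm1_vec (u - v)"
      using ny by (simp add: field_simps)
  next
    fix h dQ df
    assume h: "0 < h" and dQ: "dQ \<in> carrier_mat m n" and df: "df \<in> carrier_vec m"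
      and P: "norm_F (hcat_vec dQ df) \<le> h * NF"
    note Hc = hcat_vec_carrier[OF dQ, of df]
    have "\<bar>dQ $$ (i, j)\<bar> \<le> h * NF" if "i < m" "j < n" for i j
      using abs_nth_le_norm_F[OF Hc that(1), of j] hcat_vec_nth(1)[OF dQ that] that P by simp
    then have "(\<Sum>i<m. \<Sum>j<n. \<bar>dQ $$ (i, j)\<bar>) \<le> (\<Sum>i<m. \<Sum>j<n. h * NF)"
      by (intro sum_mono) auto
    then have "norm1_mat dQ \<le> real (m * n) * (h * NF)"
      using dQ by (simp add: norm1_mat_def algebra_simps)
    moreover have "\<bar>df $ i\<bar> \<le> h * NF" if "i < m" for i
      using abs_nth_le_norm_F[OF Hc that, of n] hcat_vec_nth(2)[OF dQ that] P by simp
    then have "(\<Sum>i<m. \<bar>df $ i\<bar>) \<le> (\<Sum>i<m. h * NF)"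
      by (intro sum_mono) auto
    then have "norm1_vec df \<le> real m * (h * NF)"
      using df by (simp add: norm1_vec_def)
    moreover have "(real (m * n + m) * NF + 1) * h = real (m * n) * (h * NF) + real m * (h * NF) + h"
      by (simp add: algebra_simps)
    moreover have "0 \<le> real (m * n) * (h * NF)" "0 \<le> real m * (h * NF)"
      using h NF by simp_all
    ultimately show "norm1_mat dQ \<le> (real (m * n + m) * NF + 1) * h \<and>
        norm1_vec df \<le> (real (m * n + m) * NF + 1) * h"
      using h by linarith
  next
    fix h T df
    assume h: "0 < h" and T: "T \<in> toeplitz_space n m" and df: "df \<in> carrier_vec m"
      and P: "norm_F (hcat_vec (transpose_mat T) df) \<le> h * NF"
    note t = vec_T_carrier[OF toeplitz_space_carrier[OF T]]
    let ?x = "(D_T n m *\<^sub>v vec_T T) @\<^sub>v df"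
    have x: "?x \<in> carrier_vec (?l + m)" using D t df by auto
    have "norm2_vec (first_order (vec_T T) df) = norm2_vec (H *\<^sub>v ?x)"
      unfolding H_mult[OF t df] norm2_vec_uminus ..
    also have "\<dots> \<le> norm2_mat H * norm2_vec ?x"
      by (rule norm2_mat_mult_le[OF H x])
    also have "\<dots> \<le> norm2_mat H * (h * NF)"
      using P norm_F_hcat_vec_toeplitz[OF T df] by (intro mult_left_mono norm2_mat_nonneg) simp
    finally show "norm2_vec (first_order (vec_T T) df) / ny \<le> h * (norm2_mat H * NF / ny)"
      using ny by (simp add: field_simps)
  next
    fix h e :: real assume h: "0 < h" and e: "0 < e"
    \<comment> \<open>Adding \<open>1\<close> to \<open>NF\<close> avoids a case distinction on whether \<open>NF\<close> vanishes.\<close>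
    define e' where "e' = e * ny / (NF + 1)"
    have e': "0 < e'" using e ny NF by (simp add: e'_def)
    obtain x where x: "x \<in> carrier_vec (?l + m)" "norm2_vec x \<le> 1" "norm2_mat H - e' < norm2_vec (H *\<^sub>v x)"
      using norm2_mat_approx[OF e', of H] H by auto
    define s where "s = h * NF"
    have s: "0 \<le> s" using h NF by (simp add: s_def)
    define x1 where "x1 = vec_first x ?l"
    define x2 where "x2 = vec_last x m"
    have x12: "x1 \<in> carrier_vec ?l" "x2 \<in> carrier_vec m" "x = x1 @\<^sub>v x2"
      using x(1) by (auto simp: x1_def x2_def)
    \<comment> \<open>The perturbation whose coordinates are \<open>s x\<close>.\<close>
    define t where "t = V *\<^sub>v (s \<cdot>\<^sub>v x1)"
    define df where "df = s \<cdot>\<^sub>v x2"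
    have sx1: "s \<cdot>\<^sub>v x1 \<in> carrier_vec ?l" using x12 by simp
    have t: "t \<in> carrier_vec ?l" and df: "df \<in> carrier_vec m"
      using x12 V by (auto simp: t_def df_def)
    have "D_T n m *\<^sub>v t = s \<cdot>\<^sub>v x1"
      unfolding t_def using assoc_mult_mat_vec[OF D V(1) sx1] V(3) sx1 by simp
    then have Dx: "(D_T n m *\<^sub>v t) @\<^sub>v df = s \<cdot>\<^sub>v x"
      unfolding df_def using x12 by (intro eq_vecI) auto
    obtain T where T: "T \<in> toeplitz_space n m" "vec_T T = t"
      using vec_T_surj[OF n_pos m_pos t] .
    have "norm_F (hcat_vec (transpose_mat T) df) = s * norm2_vec x"
      unfolding norm_F_hcat_vec_toeplitz[OF T(1) df] T(2) Dx norm2_vec_smult using s by simp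
    also have "\<dots> \<le> h * NF"
      using mult_left_mono[OF x(2) s] by (simp add: s_def)
    finally have P: "norm_F (hcat_vec (transpose_mat T) df) \<le> h * NF" .
    have "norm2_vec (first_order (vec_T T) df) = norm2_vec (H *\<^sub>v (s \<cdot>\<^sub>v x))"
      unfolding T(2) Dx[symmetric] H_mult[OF t df] norm2_vec_uminus ..
    also have "\<dots> = s * norm2_vec (H *\<^sub>v x)"
      unfolding mult_mat_vec[OF H x(1)] norm2_vec_smult using s by simp
    also have "\<dots> \<ge> s * (norm2_mat H - e')"
      using x(3) s by (intro mult_left_mono) auto
    finally have "s * (norm2_mat H - e') / ny \<le> norm2_vec (first_order (vec_T T) df) / ny"
      using ny by (intro divide_right_mono) auto
    moreover have "h * (norm2_mat H * NF / ny - e) \<le> s * (norm2_mat H - e') / ny"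
    proof -
      have "NF * e' \<le> e * ny"
        using NF e ny by (simp add: e'_def field_simps)
      then have "h * (NF * e' / ny) \<le> h * e"
        using h ny by (intro mult_left_mono) (auto simp: field_simps)
      moreover have "s * (norm2_mat H - e') / ny = h * (norm2_mat H * NF / ny) - h * (NF * e' / ny)"
        by (simp add: s_def diff_divide_distrib algebra_simps)
      moreover have "h * (norm2_mat H * NF / ny - e) = h * (norm2_mat H * NF / ny) - h * e"
        by (rule right_diff_distrib)
      ultimately show ?thesis by linarith
    qed
    ultimately show "\<exists>T df. T \<in> toeplitz_space n m \<and> df \<in> carrier_vec m \<and>
      norm_F (hcat_vec (transpose_mat T) df) \<le> h * NF \<and>
      h * (norm2_mat H * NF / ny - e) \<le> norm2_vec (first_order (vec_T T) df) / ny"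
      using T df P by (intro exI[of _ T] exI[of _ df]) auto
  next
    show "0 < real (m * n + m) * NF + 1"
      using mult_nonneg_nonneg[OF of_nat_0_le_iff NF, of "m * n + m"] by linarith
  qed (use ny in simp)
  then show ?thesis
    unfolding normwise_sup_def[abs_def] H_def V_def NF_def ny_def by (simp add: mult.commute)
qed

text \<open>The vector of the suprema of the absolute entries of the linear part over all perturbations whose
  entries are bounded in absolute value by those of the data.\<close>

definition entrywise_bound :: "real vec" where
  "entrywise_bound = abs_mat B *\<^sub>v vec_T (abs_mat (transpose_mat Q)) + abs_mat K *\<^sub>v abs_vec f"

lemma entrywise_bound_carrier: "entrywise_bound \<in> carrier_vec n"
  using K_carrier by (intro carrier_vecI) (simp add: entrywise_bound_def abs_mat_def)

lemma entrywise_bound_nth: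
  assumes i: "i < n"
  shows "entrywise_bound $ i
    = (\<Sum>k<m + n - 1. \<bar>B $$ (i, k)\<bar> * \<bar>vec_T (transpose_mat Q) $ k\<bar>) + (\<Sum>j<m. \<bar>K $$ (i, j)\<bar> * \<bar>f $ j\<bar>)"
proof -
  have QT: "transpose_mat Q \<in> carrier_mat n m" using Q by simp
  have q: "abs_vec (vec_T (transpose_mat Q)) \<in> carrier_vec (m + n - 1)" "abs_vec f \<in> carrier_vec m"
    using vec_T_carrier[OF QT] f by (auto simp: abs_vec_def)
  have aB: "abs_mat B \<in> carrier_mat n (m + n - 1)" and aK: "abs_mat K \<in> carrier_mat n m"
    using B_carrier K_carrier by (auto simp: abs_mat_def)
  have "entrywise_bound $ i = (abs_mat B *\<^sub>v abs_vec (vec_T (transpose_mat Q))) $ i + (abs_mat K *\<^sub>v abs_vec f) $ i"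
    unfolding entrywise_bound_def vec_T_abs_mat[OF QT n_pos m_pos]
    using i aK by (subst index_add_vec) auto
  also have "\<dots> = (\<Sum>k<m + n - 1. abs_mat B $$ (i, k) * abs_vec (vec_T (transpose_mat Q)) $ k)
      + (\<Sum>j<m. abs_mat K $$ (i, j) * abs_vec f $ j)"
    unfolding mult_mat_vec_nth[OF aB q(1) i] mult_mat_vec_nth[OF aK q(2) i] ..
  also have "\<dots> = (\<Sum>k<m + n - 1. \<bar>B $$ (i, k)\<bar> * \<bar>vec_T (transpose_mat Q) $ k\<bar>) + (\<Sum>j<m. \<bar>K $$ (i, j)\<bar> * \<bar>f $ j\<bar>)"
    using i f carrier_matD[OF B_carrier] carrier_matD[OF K_carrier] carrier_vecD[OF vec_T_carrier[OF QT]]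
    by (intro arg_cong2[where f = "(+)"] sum.cong) (auto simp: abs_mat_def abs_vec_def)
  finally show ?thesis .
qed

lemma first_order_nth:
  assumes "i < n" "t \<in> carrier_vec (m + n - 1)" "df \<in> carrier_vec m"
  shows "first_order t df $ i = (\<Sum>j<m. K $$ (i, j) * df $ j) - (\<Sum>k<m + n - 1. B $$ (i, k) * t $ k)"
  unfolding first_order_def using assms B_carrier
  by (simp add: mult_mat_vec_nth[OF B_carrier] mult_mat_vec_nth[OF K_carrier] del: index_mult_mat_vec)

text \<open>Here \<open>N v\<close> is the maximum over \<open>i < n\<close> of \<open>c i * \<bar>v $ i\<bar>\<close>, as \<open>N_ge\<close> and \<open>N_ex\<close> express.\<close>

lemma entrywise_limit:
  fixes N :: "real vec \<Rightarrow> real" and c :: "nat \<Rightarrow> real"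
  assumes c: "\<And>i. i < n \<Longrightarrow> 0 \<le> c i"
    and N_ge: "\<And>v i. v \<in> carrier_vec n \<Longrightarrow> i < n \<Longrightarrow> c i * \<bar>v $ i\<bar> \<le> N v"
    and N_ex: "\<And>v. v \<in> carrier_vec n \<Longrightarrow> \<exists>i<n. N v = c i * \<bar>v $ i\<bar>"
  shows "((\<lambda>h. Sup {ereal (N dy / h) | dQ df dr dy.
      rls_perturbation W lam Q f r y dQ df dr dy \<and>
      le_mat (abs_mat (hcat_vec dQ df)) (h \<cdot>\<^sub>m abs_mat (hcat_vec Q f))}) \<longlongrightarrow>
      ereal (N entrywise_bound)) (at_right 0)"
proof -
  let ?P = "\<lambda>h dQ df. le_mat (abs_mat (hcat_vec dQ df)) (h \<cdot>\<^sub>m abs_mat (hcat_vec Q f))"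
  let ?l = "m + n - 1"
  define q where "q = vec_T (transpose_mat Q)"
  have QT: "transpose_mat Q \<in> carrier_mat n m" using Q by simp
  have q: "q \<in> carrier_vec ?l" unfolding q_def by (rule vec_T_carrier[OF QT])
  note w_nth = entrywise_bound_nth[folded q_def]
  have w_nonneg: "0 \<le> entrywise_bound $ i" if "i < n" for i
    unfolding w_nth[OF that] by (intro add_nonneg_nonneg sum_nonneg) auto
  show ?thesis
  proof (rule condition_number_limit[where c = "\<Sum>i<n. c i" and d = "norm1_mat Q + norm1_vec f + 1"])
    fix u v :: "real vec" assume u: "u \<in> carrier_vec n" and v: "v \<in> carrier_vec n"
    obtain i where i: "i < n" "N u = c i * \<bar>u $ i\<bar>" using N_ex[OF u] by blast
    have "\<bar>u $ i\<bar> \<le> \<bar>v $ i\<bar> + \<bar>u $ i - v $ i\<bar>" by linarith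
    then have "N u \<le> c i * \<bar>v $ i\<bar> + c i * \<bar>(u - v) $ i\<bar>"
      using mult_left_mono[OF _ c[OF i(1)]] i u v by (simp add: distrib_left[symmetric])
    also have "\<dots> \<le> N v + (\<Sum>i<n. c i) * norm1_vec (u - v)"
    proof (intro add_mono mult_mono)
      show "c i \<le> (\<Sum>i<n. c i)" using i c by (intro member_le_sum) auto
      show "\<bar>(u - v) $ i\<bar> \<le> norm1_vec (u - v)" using i u v by (intro abs_nth_le_norm1_vec) auto
    qed (use N_ge[OF v] i c in \<open>auto intro: sum_nonneg\<close>)
    finally show "N u \<le> N v + (\<Sum>i<n. c i) * norm1_vec (u - v)" .
  next
    show "0 \<le> (\<Sum>i<n. c i)" using c by (intro sum_nonneg) auto
    show "0 < norm1_mat Q + norm1_vec f + 1"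
      using norm1_mat_nonneg[of Q] norm1_vec_nonneg[of f] by linarith
  next
    fix h dQ df
    assume h: "0 < h" and dQ: "dQ \<in> carrier_mat m n" and df: "df \<in> carrier_vec m" and P: "?P h dQ df"
    note P' = P[unfolded le_mat_abs_hcat_vec_iff[OF dQ Q df f]]
    have "(\<Sum>i<m. \<Sum>j<n. \<bar>dQ $$ (i, j)\<bar>) \<le> (\<Sum>i<m. \<Sum>j<n. h * \<bar>Q $$ (i, j)\<bar>)"
      using P' by (intro sum_mono) auto
    then have "norm1_mat dQ \<le> h * norm1_mat Q"
      using dQ Q by (simp add: norm1_mat_def sum_distrib_left)
    moreover have "(\<Sum>i<m. \<bar>df $ i\<bar>) \<le> (\<Sum>i<m. h * \<bar>f $ i\<bar>)"
      using P' by (intro sum_mono) auto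
    then have "norm1_vec df \<le> h * norm1_vec f"
      using df f by (simp add: norm1_vec_def sum_distrib_left)
    moreover have "(norm1_mat Q + norm1_vec f + 1) * h = h * norm1_mat Q + h * norm1_vec f + h"
      by (simp add: algebra_simps)
    moreover have "0 \<le> h * norm1_mat Q" "0 \<le> h * norm1_vec f" using h by simp_all
    ultimately show "norm1_mat dQ \<le> (norm1_mat Q + norm1_vec f + 1) * h \<and>
        norm1_vec df \<le> (norm1_mat Q + norm1_vec f + 1) * h"
      using h by linarith
  next
    fix h T df
    assume h: "0 < h" and T: "T \<in> toeplitz_space n m" and df: "df \<in> carrier_vec m"
      and P: "?P h (transpose_mat T) df"
    note Tc = toeplitz_space_carrier[OF T]
    note t = vec_T_carrier[OF Tc]
    have TT: "transpose_mat T \<in> carrier_mat m n" using Tc by simp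
    note P' = P[unfolded le_mat_abs_hcat_vec_iff[OF TT Q df f]]
    have tk: "\<bar>vec_T T $ k\<bar> \<le> h * \<bar>q $ k\<bar>" if k: "k < ?l" for k
    proof -
      have "n - 1 - k < n" "k - (n - 1) < m" using k n_pos m_pos by auto
      then show ?thesis using P' k Tc Q by (auto simp: q_def vec_T_def)
    qed
    obtain i where i: "i < n" "N (first_order (vec_T T) df) = c i * \<bar>first_order (vec_T T) df $ i\<bar>"
      using N_ex[OF first_order_carrier] by blast
    have "\<bar>first_order (vec_T T) df $ i\<bar>
        \<le> \<bar>\<Sum>j<m. K $$ (i, j) * df $ j\<bar> + \<bar>\<Sum>k<?l. B $$ (i, k) * vec_T T $ k\<bar>"
      unfolding first_order_nth[OF i(1) t df] by (rule abs_triangle_ineq4)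
    also have "\<dots> \<le> (\<Sum>j<m. \<bar>K $$ (i, j) * df $ j\<bar>) + (\<Sum>k<?l. \<bar>B $$ (i, k) * vec_T T $ k\<bar>)"
      by (intro add_mono sum_abs)
    also have "\<dots> \<le> (\<Sum>j<m. \<bar>K $$ (i, j)\<bar> * (h * \<bar>f $ j\<bar>)) + (\<Sum>k<?l. \<bar>B $$ (i, k)\<bar> * (h * \<bar>q $ k\<bar>))"
      unfolding abs_mult using P' tk by (intro add_mono sum_mono mult_left_mono) auto
    also have "\<dots> = h * entrywise_bound $ i"
      unfolding w_nth[OF i(1)] by (simp add: sum_distrib_left distrib_left ac_simps)
    finally have "N (first_order (vec_T T) df) \<le> c i * (h * entrywise_bound $ i)"
      unfolding i(2) using c[OF i(1)] by (rule mult_left_mono)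
    also have "\<dots> = h * (c i * \<bar>entrywise_bound $ i\<bar>)"
      using w_nonneg[OF i(1)] by simp
    also have "\<dots> \<le> h * N entrywise_bound"
      using N_ge[OF entrywise_bound_carrier i(1)] h by (intro mult_left_mono) auto
    finally show "N (first_order (vec_T T) df) \<le> h * N entrywise_bound" .
  next
    fix h e :: real assume h: "0 < h" and e: "0 < e"
    obtain i where i: "i < n" "N entrywise_bound = c i * \<bar>entrywise_bound $ i\<bar>"
      using N_ex[OF entrywise_bound_carrier] by blast
    \<comment> \<open>The signs make all summands of the \<open>i\<close>-th entry of the linear part nonnegative.\<close>
    define t where "t = vec ?l (\<lambda>k. - (h * sgn (B $$ (i, k)) * \<bar>q $ k\<bar>))"
    define df where "df = vec m (\<lambda>j. h * sgn (K $$ (i, j)) * \<bar>f $ j\<bar>)"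
    have t: "t \<in> carrier_vec ?l" and df: "df \<in> carrier_vec m" by (simp_all add: t_def df_def)
    obtain T where T: "T \<in> toeplitz_space n m" "vec_T T = t"
      using vec_T_surj[OF n_pos m_pos t] .
    note Tc = toeplitz_space_carrier[OF T(1)]
    have TT: "transpose_mat T \<in> carrier_mat m n" using Tc by simp
    have sgn_le: "h * (\<bar>sgn a\<bar> * x) \<le> h * x" if "0 \<le> x" for a x :: real
      using that h by (simp add: sgn_if)
    have P: "?P h (transpose_mat T) df"
      unfolding le_mat_abs_hcat_vec_iff[OF TT Q df f]
    proof (intro allI impI conjI)
      fix j i' assume ij: "j < m" "i' < n"
      let ?k = "j + (n - 1) - i'"
      have k: "?k < ?l" using ij n_pos by linarith
      have "transpose_mat T $$ (j, i') = t $ ?k" "Q $$ (j, i') = q $ ?k"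
        using toeplitz_nth[OF T(1) ij(2,1)] toeplitz_nth[OF Q_toeplitz ij(2,1)] Tc Q ij
        by (simp_all add: T(2) q_def)
      then show "\<bar>transpose_mat T $$ (j, i')\<bar> \<le> h * \<bar>Q $$ (j, i')\<bar>"
        using k h sgn_le[of "\<bar>q $ ?k\<bar>" "B $$ (i, ?k)"] by (simp add: t_def abs_mult)
    next
      fix j assume "j < m"
      then show "\<bar>df $ j\<bar> \<le> h * \<bar>f $ j\<bar>"
        using h sgn_le[of "\<bar>f $ j\<bar>" "K $$ (i, j)"] by (simp add: df_def abs_mult)
    qed
    have "first_order (vec_T T) df $ i
        = (\<Sum>j<m. K $$ (i, j) * (h * sgn (K $$ (i, j)) * \<bar>f $ j\<bar>))
          - (\<Sum>k<?l. B $$ (i, k) * - (h * sgn (B $$ (i, k)) * \<bar>q $ k\<bar>))"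
      unfolding T(2) first_order_nth[OF i(1) t df] by (simp add: t_def df_def)
    also have "\<dots> = (\<Sum>j<m. h * (\<bar>K $$ (i, j)\<bar> * \<bar>f $ j\<bar>)) + (\<Sum>k<?l. h * (\<bar>B $$ (i, k)\<bar> * \<bar>q $ k\<bar>))"
      unfolding mult_minus_right sum_negf diff_minus_eq_add abs_sgn[of "K $$ _"] abs_sgn[of "B $$ _"]
      by (simp only: ac_simps)
    also have "\<dots> = h * entrywise_bound $ i"
      unfolding w_nth[OF i(1)] by (simp add: sum_distrib_left distrib_left)
    finally have "h * N entrywise_bound = c i * \<bar>first_order (vec_T T) df $ i\<bar>"
      using i(2) h by (simp add: abs_mult)
    also have "\<dots> \<le> N (first_order (vec_T T) df)"
      by (rule N_ge[OF first_order_carrier i(1)])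
    finally have "h * (N entrywise_bound - e) \<le> N (first_order (vec_T T) df)"
      using mult_pos_pos[OF h e] by (simp add: right_diff_distrib)
    then show "\<exists>T df. T \<in> toeplitz_space n m \<and> df \<in> carrier_vec m \<and> ?P h (transpose_mat T) df \<and>
        h * (N entrywise_bound - e) \<le> N (first_order (vec_T T) df)"
      using T(1) df P by blast
  qed
qed

lemma mixed_limit:
  "(mixed_sup W lam Q f r y \<longlongrightarrow> ereal (norm_inf_vec entrywise_bound / norm_inf_vec y)) (at_right 0)"
proof -
  let ?N = "\<lambda>v. norm_inf_vec v / norm_inf_vec y"
  have y0: "0 \<le> norm_inf_vec y"
    using abs_nth_le_norm_inf_vec[OF y n_pos] by linarith
  have "((\<lambda>h. Sup {ereal (?N dy / h) | dQ df dr dy.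
      rls_perturbation W lam Q f r y dQ df dr dy \<and>
      le_mat (abs_mat (hcat_vec dQ df)) (h \<cdot>\<^sub>m abs_mat (hcat_vec Q f))}) \<longlongrightarrow>
      ereal (?N entrywise_bound)) (at_right 0)"
  proof (rule entrywise_limit[where c = "\<lambda>_. 1 / norm_inf_vec y"])
    fix v :: "real vec" and i assume "v \<in> carrier_vec n" "i < n"
    then show "1 / norm_inf_vec y * \<bar>v $ i\<bar> \<le> ?N v"
      using divide_right_mono[OF abs_nth_le_norm_inf_vec y0] by simp
  next
    fix v :: "real vec" assume "v \<in> carrier_vec n"
    then show "\<exists>i<n. ?N v = 1 / norm_inf_vec y * \<bar>v $ i\<bar>"
      using norm_inf_vec_attained[OF _ n_pos] by fastforce
  qed (use y0 in simp)
  then show ?thesis unfolding mixed_sup_def[abs_def] by (simp add: mult.commute)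
qed

lemma componentwise_limit:
  assumes nz: "\<And>i. i < n \<Longrightarrow> y $ i \<noteq> 0"
  shows "(componentwise_sup W lam Q f r y \<longlongrightarrow>
    ereal (norm_inf_vec (mat_diag n (\<lambda>i. 1 / y $ i) *\<^sub>v entrywise_bound))) (at_right 0)"
proof -
  define N where "N v = norm_inf_vec (mat_diag n (\<lambda>i. 1 / y $ i) *\<^sub>v v)" for v
  have Dv: "mat_diag n (\<lambda>i. 1 / y $ i) *\<^sub>v v \<in> carrier_vec n" if "v \<in> carrier_vec n" for v
    using that by (intro mult_mat_vec_carrier[OF mat_diag_dim])
  have nth: "\<bar>(mat_diag n (\<lambda>i. 1 / y $ i) *\<^sub>v v) $ i\<bar> = 1 / \<bar>y $ i\<bar> * \<bar>v $ i\<bar>"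
    if "v \<in> carrier_vec n" "i < n" for v i
    unfolding mat_diag_mult_vec_nth[OF that] by (simp add: abs_mult)
  have N_ge: "1 / \<bar>y $ i\<bar> * \<bar>v $ i\<bar> \<le> N v" if "v \<in> carrier_vec n" "i < n" for v i
    using abs_nth_le_norm_inf_vec[OF Dv[OF that(1)] that(2)] unfolding nth[OF that] N_def .
  have N_ex: "\<exists>i<n. N v = 1 / \<bar>y $ i\<bar> * \<bar>v $ i\<bar>" if "v \<in> carrier_vec n" for v
    using norm_inf_vec_attained[OF Dv[OF that] n_pos] nth[OF that] unfolding N_def by force
  have quot: "ereal (1 / h) * norm_inf_quot dy y = ereal (N dy / h)" if "dy \<in> carrier_vec n" for h dy
  proof -
    have q: "\<bar>quot (dy $ i) (y $ i)\<bar> = ereal (1 / \<bar>y $ i\<bar> * \<bar>dy $ i\<bar>)" if "i < n" for i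
      using nz[OF that] by (simp add: quot_def)
    have "norm_inf_quot dy y = ereal (N dy)"
      unfolding norm_inf_quot_def
    proof (rule SUP_eqI)
      fix i assume "i \<in> {..<dim_vec y}"
      then show "\<bar>quot (dy $ i) (y $ i)\<bar> \<le> ereal (N dy)"
        using q N_ge[OF that] y by simp
    next
      fix z assume "\<And>i. i \<in> {..<dim_vec y} \<Longrightarrow> \<bar>quot (dy $ i) (y $ i)\<bar> \<le> z"
      then show "ereal (N dy) \<le> z"
        using N_ex[OF that] q y by (metis carrier_vecD lessThan_iff)
    qed
    then show ?thesis by simp
  qed
  have "((\<lambda>h. Sup {ereal (N dy / h) | dQ df dr dy.
      rls_perturbation W lam Q f r y dQ df dr dy \<and>
      le_mat (abs_mat (hcat_vec dQ df)) (h \<cdot>\<^sub>m abs_mat (hcat_vec Q f))}) \<longlongrightarrow>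
      ereal (N entrywise_bound)) (at_right 0)"
    using N_ge N_ex by (intro entrywise_limit[where c = "\<lambda>i. 1 / \<bar>y $ i\<bar>"]) auto
  moreover have "{ereal (N dy / h) | dQ df dr dy.
      rls_perturbation W lam Q f r y dQ df dr dy \<and>
      le_mat (abs_mat (hcat_vec dQ df)) (h \<cdot>\<^sub>m abs_mat (hcat_vec Q f))}
    = {ereal (1 / h) * norm_inf_quot dy y | dQ df dr dy.
      rls_perturbation W lam Q f r y dQ df dr dy \<and>
      le_mat (abs_mat (hcat_vec dQ df)) (h \<cdot>\<^sub>m abs_mat (hcat_vec Q f))}" for h
    using quot by (intro Collect_cong) (metis rls_perturbation_iff)
  ultimately show ?thesis unfolding componentwise_sup_def[abs_def] N_def by simp
qed

end

theorem corollary5p1: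
  fixes m n :: nat and Q W Wh S K B :: "real mat" and f y r :: "real vec" and lam :: real
  assumes "m \<ge> n"
    and "Q \<in> carrier_mat m n" and "Q \<in> toeplitz_space m n" and "vec_space.rank m Q = n"
    and "W \<in> carrier_mat m m" and "sym_pos_def W"
    and "is_spd_sqrt Wh W"
    and "lam > 0"
    and "f \<in> carrier_vec m"
    and "is_arg_min (rls_objective Wh lam Q f) (\<lambda>z. z \<in> carrier_vec n) y"
    and "y \<noteq> 0\<^sub>v n"
    and "r = W *\<^sub>v (f - Q *\<^sub>v y)"
    and "S = - (lam \<cdot>\<^sub>m 1\<^sub>m n + transpose_mat Q * W * Q)"
    and "K = - (mat_inv S * transpose_mat Q * W)"
    and "B = (kron K (mat_of_row y) + kron (mat_of_row r) (mat_inv S)) * Phi_T n m"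
  shows
    "((normwise_sup W lam Q f r y \<longlongrightarrow> normwise_cond W lam Q f r y) (at_right 0) \<and>
      normwise_cond W lam Q f r y =
        ereal (norm2_mat (hcat (B * mat_inv (D_T n m)) (- K)) * norm_F (hcat_vec Q f)
               / norm2_vec y)) \<and>
     ((mixed_sup W lam Q f r y \<longlongrightarrow> mixed_cond W lam Q f r y) (at_right 0) \<and>
      mixed_cond W lam Q f r y =
        ereal (norm_inf_vec (abs_mat B *\<^sub>v vec_T (abs_mat (transpose_mat Q))
                             + abs_mat K *\<^sub>v abs_vec f)
               / norm_inf_vec y)) \<and>
     ((\<forall>i<n. y $ i \<noteq> 0) \<longrightarrow>
      (componentwise_sup W lam Q f r y \<longlongrightarrow> componentwise_cond W lam Q f r y) (at_right 0) \<and>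
      componentwise_cond W lam Q f r y =
        ereal (norm_inf_vec (pinv (diag_vec y) * abs_mat B *\<^sub>v vec_T (abs_mat (transpose_mat Q))
                             + pinv (diag_vec y) * abs_mat K *\<^sub>v abs_vec f)))"
proof -
  have y: "y \<in> carrier_vec n" using assms(10) by (simp add: is_arg_min_def)
  have n: "0 < n"
  proof (rule ccontr)
    assume "\<not> 0 < n"
    then have "y = 0\<^sub>v n" using y by (auto simp: vec_eq_iff)
    then show False using assms(11) by simp
  qed
  have normal: "transpose_mat Q *\<^sub>v r = lam \<cdot>\<^sub>v y"
    unfolding assms(12) by (rule rls_minimizer_normal_equation[OF assms(2,5,6,7,8,9,10)])
  interpret L: rls_solution m n Q W f y r lam
    by unfold_locales
      (use assms n y normal toeplitz_space_transpose[OF assms(3)] in auto)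
  have Sinv: "L.Sinv = mat_inv S" unfolding L.Sinv_def L.gram_def assms(13) ..
  have K: "L.K = K" unfolding L.K_def Sinv assms(14) ..
  have B: "L.B = B" unfolding L.B_def Sinv K assms(15) ..
  have w: "L.entrywise_bound = abs_mat B *\<^sub>v vec_T (abs_mat (transpose_mat Q)) + abs_mat K *\<^sub>v abs_vec f"
    unfolding L.entrywise_bound_def B K ..
  have cond: "(F \<longlongrightarrow> Lim (at_right (0::real)) F) (at_right 0) \<and> Lim (at_right 0) F = l"
    if "(F \<longlongrightarrow> l) (at_right 0)" for F :: "real \<Rightarrow> ereal" and l
    using that tendsto_Lim[OF trivial_limit_at_right_real that] by simp
  show ?thesis
  proof (intro conjI[of "_ \<and> _"] impI)
    show "(normwise_sup W lam Q f r y \<longlongrightarrow> normwise_cond W lam Q f r y) (at_right 0) \<and>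
      normwise_cond W lam Q f r y =
        ereal (norm2_mat (hcat (B * mat_inv (D_T n m)) (- K)) * norm_F (hcat_vec Q f) / norm2_vec y)"
      unfolding normwise_cond_def by (rule cond[OF L.normwise_limit[OF assms(11), unfolded B K]])
    show "(mixed_sup W lam Q f r y \<longlongrightarrow> mixed_cond W lam Q f r y) (at_right 0) \<and>
      mixed_cond W lam Q f r y =
        ereal (norm_inf_vec (abs_mat B *\<^sub>v vec_T (abs_mat (transpose_mat Q))
                             + abs_mat K *\<^sub>v abs_vec f) / norm_inf_vec y)"
      unfolding mixed_cond_def by (rule cond[OF L.mixed_limit[unfolded w]])
  next
    assume nz: "\<forall>i<n. y $ i \<noteq> 0"
    let ?D = "mat_diag n (\<lambda>i. 1 / y $ i)"
    have D: "?D \<in> carrier_mat n n" by simp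
    have pinv: "pinv (diag_vec y) = ?D" using pinv_diag_vec[OF y] nz by blast
    have aB: "abs_mat B \<in> carrier_mat n (m + n - 1)" and aK: "abs_mat K \<in> carrier_mat n m"
      using L.B_carrier L.K_carrier by (auto simp: abs_mat_def B K)
    have q: "vec_T (abs_mat (transpose_mat Q)) \<in> carrier_vec (m + n - 1)" and af: "abs_vec f \<in> carrier_vec m"
      using assms(2,9) vec_T_carrier[of "abs_mat (transpose_mat Q)" n m] by (auto simp: abs_mat_def abs_vec_def)
    have "?D *\<^sub>v L.entrywise_bound = ?D * abs_mat B *\<^sub>v vec_T (abs_mat (transpose_mat Q)) + ?D * abs_mat K *\<^sub>v abs_vec f"
      unfolding w assoc_mult_mat_vec[OF D aB q] assoc_mult_mat_vec[OF D aK af]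
      by (rule mult_add_distrib_mat_vec[OF D mult_mat_vec_carrier[OF aB q] mult_mat_vec_carrier[OF aK af]])
    then have lim: "(componentwise_sup W lam Q f r y \<longlongrightarrow>
        ereal (norm_inf_vec (pinv (diag_vec y) * abs_mat B *\<^sub>v vec_T (abs_mat (transpose_mat Q))
                             + pinv (diag_vec y) * abs_mat K *\<^sub>v abs_vec f))) (at_right 0)"
      using L.componentwise_limit nz unfolding pinv by presburger
    show "(componentwise_sup W lam Q f r y \<longlongrightarrow> componentwise_cond W lam Q f r y) (at_right 0) \<and>
      componentwise_cond W lam Q f r y =
        ereal (norm_inf_vec (pinv (diag_vec y) * abs_mat B *\<^sub>v vec_T (abs_mat (transpose_mat Q))
                             + pinv (diag_vec y) * abs_mat K *\<^sub>v abs_vec f))"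
      unfolding componentwise_cond_def by (rule cond[OF lim])
  qed
qed

end
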